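(* Given a two-counter machine $M$ and a configuration $s\in\mathcal{S}\Sigma_M$ with $s\le T_M$, one can compute a term $\rho\in\mathcal{T}\ddot\Sigma_M$ such that: if $s\to_{R_M}^* c_1$, then the inequality $$s_rR_M^*\le \Sigma_M^*(C_M+c_1)_r+\Sigma_M^*\Sigma_M^{\neq}\rho$$ holds in $\mathcal{T}\ddot\Sigma_M$ (i.e. is derivable in pre-Kleene algebra).
   Context: Pre-Kleene algebra: constants $0,1$, operations $+,\cdot,{}^*$ with $(+,0)$ a commutative idempotent monoid, $(\cdot,1)$ a monoid, two-sided distributivity, $0$ absorbing, and $x^*=1+xx^*$; order $x\le y$ iff $x+y=y$. A commutable set is a set with a reflexive symmetric relation $\sim$ (discrete if $\sim$ is equality). $\mathcal{S}Y$: strings over $Y$ modulo $xy=yx$ for $x\sim y$. $\mathcal{T}Y$: free pre-Kleene algebra on $Y$ subject to $xy=yx$ for $x\sim y$ (strings embed in it). A finite set of elements is identified with their sum. $\ddot Y$ is $\{y_l\}\cup\{y_r\}$ ($y\in Y$) with $y_l\sim y'_r$ always, $y_l\sim y'_l$ iff $y\sim y'$, $y_r\sim y'_r$ iff $y\sim y'$. $(-)_l,(-)_r:\mathcal{T}Y\to\mathcal{T}\ddot Y$ send $y$ to $y_l$, resp. $y_r$; a term or string over $Y$ without subscript is regarded in $\mathcal{T}\ddot Y$ via $y\mapsto y_ly_r$. For strings $s,s'$ and $e\in\mathcal{T}\ddot Y$, $s\to_e s'$ means $s_ls'_r\le e$; $\to_e^*$ is its reflexive transitive closure. A two-counter machine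 $M=(Q_M,\dot q,\iota)$: finite state set $Q_M$, initial state $\dot q$, $\iota:Q_M\to I_M$ with instructions $\mathrm{Inc}(r,q)$, $\mathrm{If}(r,q,q')$ ($r\in\{1,2\}$), $\mathrm{Halt}(x)$ ($x\in\{0,1\}$). $\Sigma_M=Q_M\uplus\{a,b,c_0,c_1\}$ discrete; $C_M=a^*b^*Q_M$, $T_M=C_M+c_0+c_1$ in $\mathcal{T}\Sigma_M$. In $\mathcal{T}\ddot\Sigma_M$: $[\![\mathrm{Inc}(1,q)]\!]=a_r(a_la_r)^*(b_lb_r)^*q_r$, $[\![\mathrm{Inc}(2,q)]\!]=(a_la_r)^*b_r(b_lb_r)^*q_r$, $[\![\mathrm{If}(1,q_1,q_2)]\!]=(b_lb_r)^*(q_1)_r+a_l(a_la_r)^*(b_lb_r)^*(q_2)_r$, $[\![\mathrm{If}(2,q_1,q_2)]\!]=(a_la_r)^*(q_1)_r+(a_la_r)^*b_l(b_lb_r)^*(q_2)_r$, $[\![\mathrm{Halt}(x)]\!]=(c_x)_r$; $R_M=\sum_{q\in Q_M}[\![\iota(q)]\!]q_l$. $\Sigma_M^*=(\sum_{x\in\Sigma_M}x_lx_r)^*$ and $\Sigma_M^{\neq}=\sum_{x\neq y}x_ly_r$ ($x,y\in\Sigma_M$). *)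

theory Defs
  imports Main "HOL-Library.Nat_Bijection"
begin

section \<open>Commutable sets, strings and free pre-Kleene algebras\<close>

record 'a comset =
  carr :: "'a set"
  comm :: "'a \<Rightarrow> 'a \<Rightarrow> bool"

definition commutable_set :: "'a comset \<Rightarrow> bool" where
  "commutable_set Y \<longleftrightarrow>
     (\<forall>x\<in>carr Y. comm Y x x) \<and> (\<forall>x\<in>carr Y. \<forall>y\<in>carr Y. comm Y x y \<longrightarrow> comm Y y x)"

definition discrete_comset :: "'a set \<Rightarrow> 'a comset" where
  "discrete_comset X = \<lparr>carr = X, comm = (=)\<rparr>"

text \<open>
  \<open>str_eq Y\<close> is the monoid congruence on strings over \<open>Y\<close> generated by \<open>xy = yx\<close> for \<open>x \<sim> y\<close>;
  the elements of \<open>\<S>Y\<close> are its classes \<open>str_class Y w\<close> for \<open>w \<in> lists (carr Y)\<close>.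
\<close>

inductive str_eq :: "'a comset \<Rightarrow> 'a list \<Rightarrow> 'a list \<Rightarrow> bool" for Y where
  str_refl: "u \<in> lists (carr Y) \<Longrightarrow> str_eq Y u u"
| str_sym: "str_eq Y u v \<Longrightarrow> str_eq Y v u"
| str_trans: "str_eq Y u v \<Longrightarrow> str_eq Y v w \<Longrightarrow> str_eq Y u w"
| str_swap: "u \<in> lists (carr Y) \<Longrightarrow> v \<in> lists (carr Y) \<Longrightarrow> x \<in> carr Y \<Longrightarrow> y \<in> carr Y \<Longrightarrow> comm Y x y
    \<Longrightarrow> str_eq Y (u @ [x, y] @ v) (u @ [y, x] @ v)"

definition str_class :: "'a comset \<Rightarrow> 'a list \<Rightarrow> 'a list set" where
  "str_class Y w = {v. str_eq Y w v}"

datatype 'a ktm =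
    KZero
  | KOne
  | Var 'a
  | KPlus "'a ktm" "'a ktm" (infixl "\<oplus>" 65)
  | KTimes "'a ktm" "'a ktm" (infixl "\<odot>" 70)
  | KStar "'a ktm"

definition terms :: "'a comset \<Rightarrow> 'a ktm set" where
  "terms Y = {t. set_ktm t \<subseteq> carr Y}"

text \<open>
  Elements of the free pre-Kleene algebra \<open>\<T>Y\<close> are given by terms over \<open>Y\<close>; two terms denote the
  same element iff they are related by \<open>pka_eq Y\<close>, derivability from the pre-Kleene algebra axioms
  and the commutativity conditions of \<open>Y\<close>.
\<close>

inductive pka_eq :: "'a comset \<Rightarrow> 'a ktm \<Rightarrow> 'a ktm \<Rightarrow> bool" for Y where
  eq_refl: "t \<in> terms Y \<Longrightarrow> pka_eq Y t t"
| eq_sym: "pka_eq Y t u \<Longrightarrow> pka_eq Y u t"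
| eq_trans: "pka_eq Y t u \<Longrightarrow> pka_eq Y u v \<Longrightarrow> pka_eq Y t v"
| cong_plus: "pka_eq Y t t' \<Longrightarrow> pka_eq Y u u' \<Longrightarrow> pka_eq Y (t \<oplus> u) (t' \<oplus> u')"
| cong_times: "pka_eq Y t t' \<Longrightarrow> pka_eq Y u u' \<Longrightarrow> pka_eq Y (t \<odot> u) (t' \<odot> u')"
| cong_star: "pka_eq Y t t' \<Longrightarrow> pka_eq Y (KStar t) (KStar t')"
| plus_assoc: "t \<in> terms Y \<Longrightarrow> u \<in> terms Y \<Longrightarrow> v \<in> terms Y
    \<Longrightarrow> pka_eq Y ((t \<oplus> u) \<oplus> v) (t \<oplus> (u \<oplus> v))"
| plus_comm: "t \<in> terms Y \<Longrightarrow> u \<in> terms Y \<Longrightarrow> pka_eq Y (t \<oplus> u) (u \<oplus> t)"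
| plus_zero: "t \<in> terms Y \<Longrightarrow> pka_eq Y (t \<oplus> KZero) t"
| plus_idem: "t \<in> terms Y \<Longrightarrow> pka_eq Y (t \<oplus> t) t"
| times_assoc: "t \<in> terms Y \<Longrightarrow> u \<in> terms Y \<Longrightarrow> v \<in> terms Y
    \<Longrightarrow> pka_eq Y ((t \<odot> u) \<odot> v) (t \<odot> (u \<odot> v))"
| one_times: "t \<in> terms Y \<Longrightarrow> pka_eq Y (KOne \<odot> t) t"
| times_one: "t \<in> terms Y \<Longrightarrow> pka_eq Y (t \<odot> KOne) t"
| distrib_left: "t \<in> terms Y \<Longrightarrow> u \<in> terms Y \<Longrightarrow> v \<in> terms Y
    \<Longrightarrow> pka_eq Y (t \<odot> (u \<oplus> v)) (t \<odot> u \<oplus> t \<odot> v)"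
| distrib_right: "t \<in> terms Y \<Longrightarrow> u \<in> terms Y \<Longrightarrow> v \<in> terms Y
    \<Longrightarrow> pka_eq Y ((t \<oplus> u) \<odot> v) (t \<odot> v \<oplus> u \<odot> v)"
| zero_times: "t \<in> terms Y \<Longrightarrow> pka_eq Y (KZero \<odot> t) KZero"
| times_zero: "t \<in> terms Y \<Longrightarrow> pka_eq Y (t \<odot> KZero) KZero"
| star_unfold: "t \<in> terms Y \<Longrightarrow> pka_eq Y (KStar t) (KOne \<oplus> t \<odot> KStar t)"
| var_comm: "x \<in> carr Y \<Longrightarrow> y \<in> carr Y \<Longrightarrow> comm Y x y
    \<Longrightarrow> pka_eq Y (Var x \<odot> Var y) (Var y \<odot> Var x)"

definition pka_le :: "'a comset \<Rightarrow> 'a ktm \<Rightarrow> 'a ktm \<Rightarrow> bool" where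
  "pka_le Y t u \<longleftrightarrow> pka_eq Y (t \<oplus> u) u"

definition str_term :: "'a list \<Rightarrow> 'a ktm" where
  "str_term w = foldr (\<lambda>y t. Var y \<odot> t) w KOne"

text \<open>Finite sums are taken along a list; up to \<open>pka_eq\<close> neither order nor repetition matters.\<close>

definition ksum :: "'a ktm list \<Rightarrow> 'a ktm" where
  "ksum ts = foldr (\<oplus>) ts KZero"

primrec ksubst :: "('a \<Rightarrow> 'b ktm) \<Rightarrow> 'a ktm \<Rightarrow> 'b ktm" where
  "ksubst h KZero = KZero"
| "ksubst h KOne = KOne"
| "ksubst h (Var y) = h y"
| "ksubst h (t \<oplus> u) = ksubst h t \<oplus> ksubst h u"
| "ksubst h (t \<odot> u) = ksubst h t \<odot> ksubst h u"
| "ksubst h (KStar t) = KStar (ksubst h t)"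

section \<open>Reg2-track alphabets and the relation of a term\<close>

datatype 'a dd = Lft 'a | Rgt 'a

fun dd_comm :: "('a \<Rightarrow> 'a \<Rightarrow> bool) \<Rightarrow> 'a dd \<Rightarrow> 'a dd \<Rightarrow> bool" where
  "dd_comm r (Lft x) (Lft y) = r x y"
| "dd_comm r (Rgt x) (Rgt y) = r x y"
| "dd_comm r (Lft x) (Rgt y) = True"
| "dd_comm r (Rgt x) (Lft y) = True"

definition ddot :: "'a comset \<Rightarrow> 'a dd comset" where
  "ddot Y = \<lparr>carr = Lft ` carr Y \<union> Rgt ` carr Y, comm = dd_comm (comm Y)\<rparr>"

definition lterm :: "'a ktm \<Rightarrow> 'a dd ktm" where
  "lterm = ksubst (\<lambda>y. Var (Lft y))"

definition rterm :: "'a ktm \<Rightarrow> 'a dd ktm" where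
  "rterm = ksubst (\<lambda>y. Var (Rgt y))"

text \<open>The implicit reading of an unsubscripted term over \<open>Y\<close> in the two-track algebra.\<close>

definition bterm :: "'a ktm \<Rightarrow> 'a dd ktm" where
  "bterm = ksubst (\<lambda>y. Var (Lft y) \<odot> Var (Rgt y))"

definition trans_rel :: "'a comset \<Rightarrow> 'a dd ktm \<Rightarrow> ('a list set \<times> 'a list set) set" where
  "trans_rel Y e = {(str_class Y w, str_class Y w') | w w'.
     w \<in> lists (carr Y) \<and> w' \<in> lists (carr Y) \<and>
     pka_le (ddot Y) (lterm (str_term w) \<odot> rterm (str_term w')) e}"

section \<open>Reg2-counter machines\<close>

datatype counter = Reg1 | Reg2

text \<open>The halting values \<open>0\<close> and \<open>1\<close> are \<open>False\<close> and \<open>True\<close>.\<close>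

datatype instruction = Inc counter nat | IfZ counter nat nat | Halt bool

text \<open>
  So that machines can be inputs of a computation, states are natural numbers; the state set is an
  arbitrary finite set of them. The function \<open>instr\<close> matters on \<open>states\<close> only.
\<close>

record machine =
  states :: "nat set"
  init :: nat
  instr :: "nat \<Rightarrow> instruction"

fun targets :: "instruction \<Rightarrow> nat set" where
  "targets (Inc r q) = {q}"
| "targets (IfZ r q q') = {q, q'}"
| "targets (Halt x) = {}"

definition two_counter_machine :: "machine \<Rightarrow> bool" where
  "two_counter_machine M \<longleftrightarrow> finite (states M) \<and> init M \<in> states M \<and>
     (\<forall>q\<in>states M. targets (instr M q) \<subseteq> states M)"

datatype sym = St nat | SymA | SymB | SymC bool

definition state_list :: "machine \<Rightarrow> nat list" where
  "state_list M = sorted_list_of_set (states M)"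

definition sym_list :: "machine \<Rightarrow> sym list" where
  "sym_list M = map St (state_list M) @ [SymA, SymB, SymC False, SymC True]"

definition Sig :: "machine \<Rightarrow> sym comset" where
  "Sig M = discrete_comset (St ` states M \<union> {SymA, SymB, SymC False, SymC True})"

definition CM :: "machine \<Rightarrow> sym ktm" where
  "CM M = KStar (Var SymA) \<odot> KStar (Var SymB) \<odot> ksum (map (\<lambda>q. Var (St q)) (state_list M))"

definition TM :: "machine \<Rightarrow> sym ktm" where
  "TM M = CM M \<oplus> Var (SymC False) \<oplus> Var (SymC True)"

abbreviation vl :: "'a \<Rightarrow> 'a dd ktm" where "vl x \<equiv> Var (Lft x)"
abbreviation vr :: "'a \<Rightarrow> 'a dd ktm" where "vr x \<equiv> Var (Rgt x)"

fun instr_term :: "instruction \<Rightarrow> sym dd ktm" where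
  "instr_term (Inc Reg1 q) =
     vr SymA \<odot> KStar (vl SymA \<odot> vr SymA) \<odot> KStar (vl SymB \<odot> vr SymB) \<odot> vr (St q)"
| "instr_term (Inc Reg2 q) =
     KStar (vl SymA \<odot> vr SymA) \<odot> vr SymB \<odot> KStar (vl SymB \<odot> vr SymB) \<odot> vr (St q)"
| "instr_term (IfZ Reg1 q1 q2) =
     KStar (vl SymB \<odot> vr SymB) \<odot> vr (St q1) \<oplus>
     vl SymA \<odot> KStar (vl SymA \<odot> vr SymA) \<odot> KStar (vl SymB \<odot> vr SymB) \<odot> vr (St q2)"
| "instr_term (IfZ Reg2 q1 q2) =
     KStar (vl SymA \<odot> vr SymA) \<odot> vr (St q1) \<oplus>
     KStar (vl SymA \<odot> vr SymA) \<odot> vl SymB \<odot> KStar (vl SymB \<odot> vr SymB) \<odot> vr (St q2)"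
| "instr_term (Halt x) = vr (SymC x)"

definition RM :: "machine \<Rightarrow> sym dd ktm" where
  "RM M = ksum (map (\<lambda>q. instr_term (instr M q) \<odot> vl (St q)) (state_list M))"

definition Sig_star :: "machine \<Rightarrow> sym dd ktm" where
  "Sig_star M = bterm (KStar (ksum (map Var (sym_list M))))"

definition Sig_neq :: "machine \<Rightarrow> sym dd ktm" where
  "Sig_neq M = ksum [vl x \<odot> vr y. x \<leftarrow> sym_list M, y \<leftarrow> sym_list M, x \<noteq> y]"

section \<open>Computability\<close>

text \<open>
  Partial recursive functions, in the unary presentation based on the Cantor pairing
  \<open>prod_encode\<close>: initial functions, pairing, composition, primitive recursion and unbounded search.
\<close>

definition search :: "(nat \<Rightarrow> nat option) \<Rightarrow> nat option" where
  "search g = (if \<exists>n. g n = Some 0 \<and> (\<forall>m<n. g m \<noteq> None)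
               then Some (LEAST n. g n = Some 0) else None)"

inductive partial_recursive :: "(nat \<Rightarrow> nat option) \<Rightarrow> bool" where
  pr_zero: "partial_recursive (\<lambda>n. Some 0)"
| pr_succ: "partial_recursive (\<lambda>n. Some (Suc n))"
| pr_fst: "partial_recursive (\<lambda>n. Some (fst (prod_decode n)))"
| pr_snd: "partial_recursive (\<lambda>n. Some (snd (prod_decode n)))"
| pr_pair: "partial_recursive f \<Longrightarrow> partial_recursive g \<Longrightarrow>
    partial_recursive (\<lambda>n. Option.bind (f n) (\<lambda>x. Option.bind (g n) (\<lambda>y. Some (prod_encode (x, y)))))"
| pr_comp: "partial_recursive f \<Longrightarrow> partial_recursive g \<Longrightarrow>
    partial_recursive (\<lambda>n. Option.bind (g n) f)"
| pr_prec: "partial_recursive f \<Longrightarrow> partial_recursive g \<Longrightarrow>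
    partial_recursive (\<lambda>n. rec_nat (f (fst (prod_decode n)))
      (\<lambda>k r. Option.bind r (\<lambda>i. g (prod_encode (fst (prod_decode n), prod_encode (k, i)))))
      (snd (prod_decode n)))"
| pr_search: "partial_recursive f \<Longrightarrow>
    partial_recursive (\<lambda>n. search (\<lambda>k. f (prod_encode (n, k))))"

text \<open>Goedel numberings of the inputs (a machine and a string) and of the output (a term).\<close>

fun counter_code :: "counter \<Rightarrow> nat" where
  "counter_code Reg1 = 0"
| "counter_code Reg2 = 1"

fun instr_code :: "instruction \<Rightarrow> nat" where
  "instr_code (Inc r q) = prod_encode (0, prod_encode (counter_code r, q))"
| "instr_code (IfZ r q q') = prod_encode (1, prod_encode (counter_code r, prod_encode (q, q')))"
| "instr_code (Halt x) = prod_encode (2, of_bool x)"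

definition machine_code :: "machine \<Rightarrow> nat" where
  "machine_code M = prod_encode (init M,
     list_encode (map (\<lambda>q. prod_encode (q, instr_code (instr M q))) (state_list M)))"

fun sym_code :: "sym \<Rightarrow> nat" where
  "sym_code (St q) = prod_encode (0, q)"
| "sym_code SymA = prod_encode (1, 0)"
| "sym_code SymB = prod_encode (2, 0)"
| "sym_code (SymC x) = prod_encode (3, of_bool x)"

definition input_code :: "machine \<Rightarrow> sym list \<Rightarrow> nat" where
  "input_code M w = prod_encode (machine_code M, list_encode (map sym_code w))"

fun dd_code :: "sym dd \<Rightarrow> nat" where
  "dd_code (Lft x) = prod_encode (0, sym_code x)"
| "dd_code (Rgt x) = prod_encode (1, sym_code x)"

primrec term_code :: "sym dd ktm \<Rightarrow> nat" where
  "term_code KZero = prod_encode (0, 0)"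
| "term_code KOne = prod_encode (1, 0)"
| "term_code (Var x) = prod_encode (2, dd_code x)"
| "term_code (t \<oplus> u) = prod_encode (3, prod_encode (term_code t, term_code u))"
| "term_code (t \<odot> u) = prod_encode (4, prod_encode (term_code t, term_code u))"
| "term_code (KStar t) = prod_encode (5, term_code t)"

section \<open>Adequacy of the definitions\<close>

lemma commutable_discrete: "commutable_set (discrete_comset X)"
  by (simp add: commutable_set_def discrete_comset_def)

lemma commutable_ddot: "commutable_set Y \<Longrightarrow> commutable_set (ddot Y)"
  unfolding commutable_set_def ddot_def by (simp add: ball_Un)

lemma set_sym_list: "finite (states M) \<Longrightarrow> set (sym_list M) = carr (Sig M)"
  by (auto simp: sym_list_def state_list_def Sig_def discrete_comset_def)

lemma str_class_discrete:
  assumes "w \<in> lists X"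
  shows "str_class (discrete_comset X) w = {w}"
proof -
  have "str_eq (discrete_comset X) u v \<Longrightarrow> u = v" for u v :: "'a list"
    by (induction rule: str_eq.induct) (auto simp: discrete_comset_def)
  moreover have "str_eq (discrete_comset X) w w"
    using assms by (intro str_refl) (simp add: discrete_comset_def)
  ultimately show ?thesis unfolding str_class_def by blast
qed

lemma pka_eq_terms: "pka_eq Y t u \<Longrightarrow> t \<in> terms Y \<and> u \<in> terms Y"
  by (induction rule: pka_eq.induct) (auto simp: terms_def)

lemma counter_code_inject: "counter_code r = counter_code r' \<longleftrightarrow> r = r'"
  by (cases r; cases r') simp_all

lemma instr_code_inject: "instr_code i = instr_code j \<longleftrightarrow> i = j"
  by (cases i; cases j) (auto simp: prod_encode_eq counter_code_inject)

lemma sym_code_inject: "sym_code x = sym_code y \<longleftrightarrow> x = y"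
  by (cases x; cases y) (auto simp: prod_encode_eq)

lemma dd_code_inject: "dd_code x = dd_code y \<longleftrightarrow> x = y"
  by (cases x; cases y) (auto simp: prod_encode_eq sym_code_inject)

lemma term_code_inject: "term_code t = term_code u \<longleftrightarrow> t = u"
proof (induction t arbitrary: u)
  case KZero show ?case by (cases u) (auto simp: prod_encode_eq)
next
  case KOne show ?case by (cases u) (auto simp: prod_encode_eq)
next
  case (Var x) show ?case by (cases u) (auto simp: prod_encode_eq dd_code_inject)
next
  case (KPlus t1 t2) thus ?case by (cases u) (auto simp: prod_encode_eq)
next
  case (KTimes t1 t2) thus ?case by (cases u) (auto simp: prod_encode_eq)
next
  case (KStar t) thus ?case by (cases u) (auto simp: prod_encode_eq)
qed

lemma input_code_inject:
  assumes "two_counter_machine M" "two_counter_machine M'" "input_code M w = input_code M' w'"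
  shows "states M = states M'" "init M = init M'" "\<forall>q\<in>states M. instr M q = instr M' q" "w = w'"
proof -
  let ?f = "\<lambda>M q. prod_encode (q, instr_code (instr M q))"
  have eq: "init M = init M'" "map (?f M) (state_list M) = map (?f M') (state_list M')"
    and sw: "map sym_code w = map sym_code w'"
    using assms(3) by (auto simp: input_code_def machine_code_def prod_encode_eq list_encode_eq)
  have "map (\<lambda>q. fst (prod_decode (?f M q))) (state_list M) =
        map (\<lambda>q. fst (prod_decode (?f M' q))) (state_list M')"
    using arg_cong[OF eq(2), of "map (fst \<circ> prod_decode)"] by (simp add: comp_def)
  hence sl: "state_list M = state_list M'" by simp
  have fin: "finite (states M)" "finite (states M')"
    using assms by (auto simp: two_counter_machine_def)
  show st: "states M = states M'"
    using arg_cong[OF sl, of set] fin by (simp add: state_list_def)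
  show "init M = init M'" by fact
  show "\<forall>q\<in>states M. instr M q = instr M' q"
  proof
    fix q assume "q \<in> states M"
    hence "q \<in> set (state_list M)" using fin by (simp add: state_list_def)
    thus "instr M q = instr M' q"
      using eq(2) unfolding sl by (auto simp: prod_encode_eq instr_code_inject)
  qed
  have "inj sym_code" by (simp add: inj_def sym_code_inject)
  thus "w = w'" using sw by (simp add: inj_map_eq_map)
qed

end

theory Submission
  imports Defs
begin

text \<open>
  A product \<open>s\<^sub>r F\<close> is read with the right-track word \<open>s\<close> as a queue: since left letters commute
  with right letters, a left letter of \<open>F\<close> meets the front of the queue and a right letter of \<open>F\<close> is
  appended to its end. If the left letter equals the front, both merge into a factor of \<open>\<Sigma>\<^sup>*\<close>; if
  not, they form a factor of \<open>\<Sigma>\<^sup>\<noteq>\<close>, and what remains (a word followed by the rest of an instruction)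
  lies below \<open>G\<^sup>*\<close>, where \<open>G\<close> is the sum of all letters of both tracks and of the two loops
  \<open>(a\<^sub>l a\<^sub>r)\<^sup>*\<close> and \<open>(b\<^sub>l b\<^sub>r)\<^sup>*\<close>. Unfolding the loops of an instruction as often as the queue requires
  gives \<open>s\<^sub>r R \<le> s s'\<^sub>r + \<Sigma>\<^sup>* \<Sigma>\<^sup>\<noteq> G\<^sup>*\<close> for the successor \<open>s'\<close> of \<open>s\<close>, and \<open>c\<^sub>1\<close> has no successor. Hence
  \<open>R\<^sup>*\<close> has to be unfolded only as often as the run has steps, no induction principle for the star
  is needed, and \<open>\<rho> = G\<^sup>* R\<^sup>*\<close> works for every \<open>s\<close>.
\<close>

section \<open>Pre-Kleene algebras\<close>

class pre_kleene_algebra = semiring_0 + monoid_mult + canonically_ordered_monoid_add +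
  fixes kstar :: "'a \<Rightarrow> 'a"
  assumes add_idem [simp]: "x + x = x"
    and kstar_unfold: "kstar x = 1 + x * kstar x"
begin

subclass ordered_semiring
proof
  fix x y z :: 'a
  assume "x \<le> y"
  then obtain d where "y = x + d" by (auto simp: le_iff_add)
  then show "z * x \<le> z * y" "x * z \<le> y * z"
    by (auto simp: algebra_simps le_iff_add)
qed

lemma add_upper1: "x \<le> x + y" and add_upper2: "y \<le> x + y"
  by (simp_all add: add_increasing add_increasing2)

lemma add_le_iff [simp]: "x + y \<le> z \<longleftrightarrow> x \<le> z \<and> y \<le> z"
proof
  assume "x + y \<le> z"
  then show "x \<le> z \<and> y \<le> z" using add_upper1 add_upper2 order_trans by blast
next
  assume "x \<le> z \<and> y \<le> z"
  then show "x + y \<le> z" using add_mono[of x z y z] by simp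
qed

lemma le_mult_of_one_le: "1 \<le> x \<Longrightarrow> y \<le> z \<Longrightarrow> y \<le> x * z"
  using mult_mono[of 1 x y z] by simp

lemma one_le_kstar: "1 \<le> kstar x"
  by (subst kstar_unfold) (rule add_upper1)

lemma mult_le_kstar:
  assumes "x \<le> y" "z \<le> kstar y"
  shows "x * z \<le> kstar y"
proof -
  have "x * z \<le> y * kstar y" using assms by (intro mult_mono) auto
  then show ?thesis by (subst kstar_unfold) (rule add_increasing[OF zero_le])
qed

lemma power_le_kstar: "x ^ n \<le> kstar x"
  by (induction n) (simp_all add: one_le_kstar mult_le_kstar)

lemma kstar_mult_unfold: "kstar x * y = y + x * (kstar x * y)"
  by (subst kstar_unfold) (simp add: algebra_simps)

end

section \<open>The free two-track algebra\<close>

lemma ksubst_Var [simp]: "ksubst Var t = t"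
  by (induction t) auto

lemma set_ktm_ksubst [simp]: "set_ktm (ksubst h t) = (\<Union>x\<in>set_ktm t. set_ktm (h x))"
  by (induction t) auto

lemma pka_eq_ksubst:
  assumes "pka_eq Y t u"
    and in_terms: "\<And>x. x \<in> carr Y \<Longrightarrow> h x \<in> terms Z"
    and commute: "\<And>x y. x \<in> carr Y \<Longrightarrow> y \<in> carr Y \<Longrightarrow> comm Y x y \<Longrightarrow>
      pka_eq Z (h x \<odot> h y) (h y \<odot> h x)"
  shows "pka_eq Z (ksubst h t) (ksubst h u)"
proof -
  have ksubst_in_terms: "ksubst h v \<in> terms Z" if "v \<in> terms Y" for v
    using that in_terms unfolding terms_def by auto
  show ?thesis
    using assms(1)
  proof (induction rule: pka_eq.induct)
    case (eq_sym t u)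
    from eq_sym.IH show ?case by (rule pka_eq.eq_sym)
  next
    case (eq_trans t u v)
    then show ?case by (blast intro: pka_eq.eq_trans)
  next
    case (var_comm x y)
    then show ?case by (simp add: commute)
  qed (simp_all add: ksubst_in_terms pka_eq.intros(1,4-))
qed

definition full :: "'a dd comset" where
  "full = ddot (discrete_comset UNIV)"

lemma carr_full [simp]: "carr full = UNIV"
  unfolding full_def ddot_def discrete_comset_def by (auto, metis dd.exhaust rangeI)

lemma terms_full [simp]: "terms full = UNIV"
  by (simp add: terms_def)

lemma comm_full: "comm full = comm (ddot (discrete_comset X))"
  by (simp add: full_def ddot_def discrete_comset_def)

lemma pka_eq_full_if_pka_eq:
  assumes "pka_eq (ddot (discrete_comset X)) t u"
  shows "pka_eq full t u"
proof -
  have "pka_eq full (ksubst Var t) (ksubst Var u)"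
    using assms by (rule pka_eq_ksubst) (simp_all add: var_comm comm_full[of X])
  then show ?thesis by simp
qed

text \<open>Substituting \<open>0\<close> for the letters outside \<open>X\<close> retracts the algebra over all letters onto the
  one over \<open>X\<close>.\<close>

lemma pka_eq_if_pka_eq_full:
  assumes "pka_eq full t u"
    and t: "t \<in> terms (ddot (discrete_comset X))" and u: "u \<in> terms (ddot (discrete_comset X))"
  shows "pka_eq (ddot (discrete_comset X)) t u"
proof -
  let ?Y = "ddot (discrete_comset X)"
  let ?retract = "\<lambda>x. if x \<in> carr ?Y then Var x else KZero"
  have id: "ksubst ?retract v = v" if "v \<in> terms ?Y" for v
    using that by (induction v) (auto simp: terms_def)
  have in_terms: "?retract x \<in> terms ?Y" "KZero \<in> terms ?Y" for x
    by (simp_all add: terms_def)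
  have zero_commute: "pka_eq ?Y (v \<odot> KZero) (KZero \<odot> v)" if "v \<in> terms ?Y" for v
    using that by (blast intro: eq_trans eq_sym zero_times times_zero)
  have "pka_eq ?Y (ksubst ?retract t) (ksubst ?retract u)"
    using assms(1)
  proof (rule pka_eq_ksubst)
    fix x y :: "'a dd" assume "comm full x y"
    then show "pka_eq ?Y (?retract x \<odot> ?retract y) (?retract y \<odot> ?retract x)"
      using zero_commute[OF in_terms(1), of x] zero_commute[OF in_terms(1), of y, THEN eq_sym]
        zero_commute[OF in_terms(2)]
      by (auto simp: comm_full[of X] intro: var_comm)
  qed (rule in_terms)
  then show ?thesis by (simp add: id t u)
qed

quotient_type 'a tracks = "'a dd ktm" / "pka_eq full" morphisms rep_tracks denot
proof (intro equivpI reflpI sympI transpI)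
  show "pka_eq full t t" for t :: "'a dd ktm" by (rule eq_refl) simp
qed (blast intro: eq_sym eq_trans)+

instantiation tracks :: (type) pre_kleene_algebra
begin

lift_definition zero_tracks :: "'a tracks" is KZero .
lift_definition one_tracks :: "'a tracks" is KOne .
lift_definition plus_tracks :: "'a tracks \<Rightarrow> 'a tracks \<Rightarrow> 'a tracks" is KPlus by (rule cong_plus)
lift_definition times_tracks :: "'a tracks \<Rightarrow> 'a tracks \<Rightarrow> 'a tracks" is KTimes by (rule cong_times)
lift_definition kstar_tracks :: "'a tracks \<Rightarrow> 'a tracks" is KStar by (rule cong_star)
definition less_eq_tracks :: "'a tracks \<Rightarrow> 'a tracks \<Rightarrow> bool" where
  "less_eq_tracks x y \<longleftrightarrow> x + y = y"
definition less_tracks :: "'a tracks \<Rightarrow> 'a tracks \<Rightarrow> bool" where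
  "less_tracks x y \<longleftrightarrow> x \<le> y \<and> \<not> y \<le> x"

instance
proof
  fix a b c :: "'a tracks"
  show assoc: "a + b + c = a + (b + c)" for a b c :: "'a tracks"
    by transfer (simp add: plus_assoc)
  show comm: "a + b = b + a" for a b :: "'a tracks" by transfer (simp add: plus_comm)
  show idem: "a + a = a" for a :: "'a tracks" by transfer (simp add: plus_idem)
  show "0 + a = a" by (subst comm, transfer) (simp add: plus_zero)
  show "a * b * c = a * (b * c)" by transfer (simp add: times_assoc)
  show "1 * a = a" "a * 1 = a" "0 * a = 0" "a * 0 = 0"
    by (transfer; simp add: one_times times_one zero_times times_zero)+
  show "(a + b) * c = a * c + b * c" "a * (b + c) = a * b + a * c"
    by (transfer; simp add: distrib_left distrib_right)+
  show "kstar a = 1 + a * kstar a" by transfer (simp add: star_unfold)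
  show "a \<le> a" by (simp add: less_eq_tracks_def idem)
  show "a \<le> b \<Longrightarrow> b \<le> c \<Longrightarrow> a \<le> c" unfolding less_eq_tracks_def by (metis assoc)
  show "a \<le> b \<Longrightarrow> b \<le> a \<Longrightarrow> a = b" unfolding less_eq_tracks_def by (metis comm)
  show "a < b \<longleftrightarrow> a \<le> b \<and> \<not> b \<le> a" by (rule less_tracks_def)
  show "a \<le> b \<longleftrightarrow> (\<exists>c. b = a + c)" unfolding less_eq_tracks_def by (metis assoc idem)
qed

end

lift_definition lvar :: "'a \<Rightarrow> 'a tracks" is "\<lambda>x. vl x" .
lift_definition rvar :: "'a \<Rightarrow> 'a tracks" is "\<lambda>x. vr x" .

abbreviation bvar :: "'a \<Rightarrow> 'a tracks" where "bvar x \<equiv> lvar x * rvar x"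

lemma denot_simps [simp]:
  "denot KZero = 0" "denot KOne = 1" "denot (t \<oplus> u) = denot t + denot u"
  "denot (t \<odot> u) = denot t * denot u" "denot (KStar t) = kstar (denot t)"
  "denot (vl x) = lvar x" "denot (vr x) = rvar x"
  by (simp_all add: zero_tracks.abs_eq one_tracks.abs_eq plus_tracks.abs_eq
      times_tracks.abs_eq kstar_tracks.abs_eq lvar.abs_eq rvar.abs_eq)

lemma denot_ksum: "denot (ksum ts) = (\<Sum>t\<leftarrow>ts. denot t)"
  by (induction ts) (auto simp: ksum_def)

lemma denot_le_iff_pka_le_full: "denot t \<le> denot u \<longleftrightarrow> pka_le full t u"
  unfolding pka_le_def less_eq_tracks_def denot_simps(3)[symmetric] by (rule tracks.abs_eq_iff)

lemma denot_le_if_pka_le: "pka_le (ddot (discrete_comset X)) t u \<Longrightarrow> denot t \<le> denot u"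
  unfolding denot_le_iff_pka_le_full pka_le_def by (rule pka_eq_full_if_pka_eq)

lemma pka_le_if_denot_le:
  assumes "denot t \<le> denot u"
    and "t \<in> terms (ddot (discrete_comset X))" "u \<in> terms (ddot (discrete_comset X))"
  shows "pka_le (ddot (discrete_comset X)) t u"
  using assms unfolding denot_le_iff_pka_le_full pka_le_def
  by (intro pka_eq_if_pka_eq_full) (auto simp: terms_def)

lemma denot_rterm_le_if_pka_le:
  assumes "pka_le (discrete_comset X) t u"
  shows "denot (rterm t) \<le> denot (rterm u)"
proof -
  have "pka_eq full (rterm (t \<oplus> u)) (rterm u)"
    unfolding rterm_def
    by (rule pka_eq_ksubst[OF assms[unfolded pka_le_def]])
      (simp_all add: discrete_comset_def eq_refl)
  then show ?thesis by (simp add: denot_le_iff_pka_le_full pka_le_def rterm_def)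
qed

lemma rvar_lvar_commute: "rvar y * lvar x = lvar x * rvar y"
  by (transfer, rule var_comm) (simp_all, simp add: full_def ddot_def)

definition lword :: "'a list \<Rightarrow> 'a tracks" where "lword w = (\<Prod>x\<leftarrow>w. lvar x)"
definition rword :: "'a list \<Rightarrow> 'a tracks" where "rword w = (\<Prod>x\<leftarrow>w. rvar x)"
definition bword :: "'a list \<Rightarrow> 'a tracks" where "bword w = (\<Prod>x\<leftarrow>w. bvar x)"

lemma word_simps [simp]:
  "lword [] = 1" "lword (x # u) = lvar x * lword u"
  "rword [] = 1" "rword (x # u) = rvar x * rword u" "rword (u @ v) = rword u * rword v"
  "bword [] = 1" "bword (x # u) = bvar x * bword u" "bword (u @ v) = bword u * bword v"
  by (simp_all add: rword_def lword_def bword_def)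

lemma denot_str_term [simp]:
  "denot (lterm (str_term w)) = lword w" "denot (rterm (str_term w)) = rword w"
  by (induction w) (auto simp: lterm_def rterm_def str_term_def)

lemma rword_replicate_le_kstar: "rword (replicate n x) \<le> kstar (rvar x)"
  by (simp add: rword_def power_le_kstar)

lemma rword_lvar_commute: "rword w * lvar x = lvar x * rword w"
proof (induction w)
  case (Cons y w)
  have "rword (y # w) * lvar x = rvar y * (rword w * lvar x)" by (simp add: mult.assoc)
  also have "\<dots> = rvar y * lvar x * rword w" by (simp add: Cons mult.assoc)
  also have "\<dots> = lvar x * rword (y # w)" by (simp add: rvar_lvar_commute mult.assoc)
  finally show ?case .
qed simp

lemma rword_lword: "rword w * lword w = bword w"
proof (induction w)
  case (Cons x w)
  have "rword (x # w) * lword (x # w) = rvar x * (rword w * lvar x) * lword w"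
    by (simp add: mult.assoc)
  also have "\<dots> = rvar x * lvar x * (rword w * lword w)"
    by (simp add: mult.assoc rword_lvar_commute)
  finally show ?case by (simp add: Cons rvar_lvar_commute)
qed simp

lemma rword_Cons_mult_lvar: "rword (y # s) * (lvar x * F) = lvar x * rvar y * (rword s * F)"
proof -
  have "rword (y # s) * (lvar x * F) = rword (y # s) * lvar x * F" by (simp only: mult.assoc)
  also have "\<dots> = lvar x * rword (y # s) * F" by (simp only: rword_lvar_commute)
  finally show ?thesis by (simp add: mult.assoc)
qed

section \<open>The model of binary relations on words\<close>

definition rel_concat ::
  "('a list \<times> 'b list) set \<Rightarrow> ('a list \<times> 'b list) set \<Rightarrow> ('a list \<times> 'b list) set" where
  "rel_concat A B = {(u @ u', v @ v') | u v u' v'. (u, v) \<in> A \<and> (u', v') \<in> B}"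

inductive_set rel_star :: "('a list \<times> 'b list) set \<Rightarrow> ('a list \<times> 'b list) set" for A where
  Nil: "([], []) \<in> rel_star A"
| append: "(u, v) \<in> A \<Longrightarrow> (u', v') \<in> rel_star A \<Longrightarrow> (u @ u', v @ v') \<in> rel_star A"

lemma rel_concatI: "(u, v) \<in> A \<Longrightarrow> (u', v') \<in> B \<Longrightarrow> (u @ u', v @ v') \<in> rel_concat A B"
  unfolding rel_concat_def by blast

lemma rel_concatE:
  assumes "p \<in> rel_concat A B"
  obtains u v u' v' where "p = (u @ u', v @ v')" "(u, v) \<in> A" "(u', v') \<in> B"
  using assms unfolding rel_concat_def by blast

lemma rel_concat_simps [simp]:
  "rel_concat {} A = {}" "rel_concat A {} = {}"
  "rel_concat {([], [])} A = A" "rel_concat A {([], [])} = A"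
  "rel_concat (A \<union> B) C = rel_concat A C \<union> rel_concat B C"
  "rel_concat A (B \<union> C) = rel_concat A B \<union> rel_concat A C"
  "rel_concat {(u, v)} {(u', v')} = {(u @ u', v @ v')}"
  by (simp_all add: rel_concat_def) blast+

lemma rel_concat_assoc: "rel_concat (rel_concat A B) C = rel_concat A (rel_concat B C)"
proof
  show "rel_concat (rel_concat A B) C \<subseteq> rel_concat A (rel_concat B C)"
    by (clarsimp elim!: rel_concatE intro!: rel_concatI)
  show "rel_concat A (rel_concat B C) \<subseteq> rel_concat (rel_concat A B) C"
    by (clarsimp elim!: rel_concatE simp flip: append_assoc intro!: rel_concatI)
qed

lemma rel_star_unfold: "rel_star A = {([], [])} \<union> rel_concat A (rel_star A)"
proof
  show "rel_star A \<subseteq> {([], [])} \<union> rel_concat A (rel_star A)"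
  proof clarify
    fix u v assume "(u, v) \<in> rel_star A" "(u, v) \<notin> rel_concat A (rel_star A)"
    then show "u = [] \<and> v = []" by cases (auto intro: rel_concatI)
  qed
  show "{([], [])} \<union> rel_concat A (rel_star A) \<subseteq> rel_star A"
    by (auto elim!: rel_concatE intro: rel_star.intros)
qed

lemma rel_star_Id_on: "(u, v) \<in> rel_star A \<Longrightarrow> A \<subseteq> Id \<Longrightarrow> u = v"
  by (induction rule: rel_star.induct) auto

lemma rel_star_singleton_right: "rel_star {([], [x])} = range (\<lambda>n. ([], replicate n x))"
proof
  have "(u, v) \<in> range (\<lambda>n. ([], replicate n x))" if "(u, v) \<in> rel_star {([], [x])}" for u v
    using that
  proof (induction rule: rel_star.induct)
    case (append u v u' v')
    then obtain n where "(u @ u', v @ v') = ([], replicate (Suc n) x)" by auto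
    then show ?case by (rule range_eqI)
  qed (auto intro: range_eqI[of _ _ 0])
  then show "rel_star {([], [x])} \<subseteq> range (\<lambda>n. ([], replicate n x))" by auto
  have "([], replicate n x) \<in> rel_star {([], [x])}" for n
    by (induction n) (auto intro: rel_star.intros rel_star.append[of "[]" "[x]" _ "[]", simplified])
  then show "range (\<lambda>n. ([], replicate n x)) \<subseteq> rel_star {([], [x])}" by auto
qed

primrec term_rel :: "'a dd ktm \<Rightarrow> ('a list \<times> 'a list) set" where
  "term_rel KZero = {}"
| "term_rel KOne = {([], [])}"
| "term_rel (Var x) = {case x of Lft y \<Rightarrow> ([y], []) | Rgt y \<Rightarrow> ([], [y])}"
| "term_rel (t \<oplus> u) = term_rel t \<union> term_rel u"
| "term_rel (t \<odot> u) = rel_concat (term_rel t) (term_rel u)"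
| "term_rel (KStar t) = rel_star (term_rel t)"

lemma term_rel_eq_if_pka_eq:
  assumes "pka_eq full t u"
  shows "term_rel t = term_rel u"
  using assms
proof (induction rule: pka_eq.induct)
  case (times_assoc t u v)
  show ?case by (simp add: rel_concat_assoc)
next
  case (star_unfold t)
  show ?case using rel_star_unfold by simp
next
  case (var_comm x y)
  then show ?case by (cases x; cases y) (auto simp: full_def ddot_def discrete_comset_def)
qed (simp_all add: Un_ac)

lift_definition word_rel :: "'a tracks \<Rightarrow> ('a list \<times> 'a list) set" is term_rel
  by (rule term_rel_eq_if_pka_eq)

lemma word_rel_simps [simp]:
  "word_rel 0 = {}" "word_rel 1 = {([], [])}" "word_rel (x + y) = word_rel x \<union> word_rel y"
  "word_rel (x * y) = rel_concat (word_rel x) (word_rel y)"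
  "word_rel (kstar x) = rel_star (word_rel x)"
  "word_rel (lvar a) = {([a], [])}" "word_rel (rvar a) = {([], [a])}"
  by (transfer; simp)+

lemma word_rel_mono: "x \<le> y \<Longrightarrow> word_rel x \<subseteq> word_rel y"
  by (auto simp: le_iff_add)

lemma word_rel_sum_list: "word_rel (sum_list xs) = (\<Union>x\<in>set xs. word_rel x)"
  by (induction xs) auto

lemma word_rel_words [simp]:
  "word_rel (lword w) = {(w, [])}" "word_rel (rword w) = {([], w)}" "word_rel (bword w) = {(w, w)}"
  by (induction w) simp_all

section \<open>Reading a queue\<close>

definition diagonal :: "'a list \<Rightarrow> 'a tracks" where
  "diagonal A = kstar (\<Sum>x\<leftarrow>A. bvar x)"

definition off_diagonal :: "'a list \<Rightarrow> 'a tracks" where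
  "off_diagonal A = sum_list [lvar x * rvar y. x \<leftarrow> A, y \<leftarrow> A, x \<noteq> y]"

lemma lvar_rvar_le_off_diagonal:
  "x \<in> set A \<Longrightarrow> y \<in> set A \<Longrightarrow> x \<noteq> y \<Longrightarrow> lvar x * rvar y \<le> off_diagonal A"
  unfolding off_diagonal_def by (rule member_le_sum_list) auto

lemma one_le_diagonal: "1 \<le> diagonal A"
  unfolding diagonal_def by (rule one_le_kstar)

lemma bword_mult_diagonal_le:
  assumes "w \<in> lists (set A)"
  shows "bword w * (diagonal A * F) \<le> diagonal A * F"
proof -
  have "bword w * diagonal A \<le> diagonal A"
    using assms
  proof (induction w)
    case (Cons x w)
    then have "bvar x \<le> (\<Sum>x\<leftarrow>A. bvar x)" by (intro member_le_sum_list) auto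
    then have "bvar x * (bword w * diagonal A) \<le> diagonal A"
      using Cons unfolding diagonal_def by (auto intro: mult_le_kstar)
    then show ?case by (simp add: mult.assoc)
  qed simp
  then have "bword w * diagonal A * F \<le> diagonal A * F" by (rule mult_right_mono) simp
  then show ?thesis by (simp add: mult.assoc)
qed

lemma word_rel_diagonal: "(u, v) \<in> word_rel (diagonal A) \<Longrightarrow> u = v"
  unfolding diagonal_def word_rel_simps
  by (erule rel_star_Id_on) (auto simp: word_rel_sum_list)

lemma word_rel_off_diagonal:
  "(u, v) \<in> word_rel (off_diagonal A) \<Longrightarrow> \<exists>x y. x \<noteq> y \<and> u = [x] \<and> v = [y]"
  by (auto simp: off_diagonal_def word_rel_sum_list split: if_splits)

locale queue =
  fixes A :: "'a list" and P :: "'a tracks"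
  assumes letter_mult_P_le: "x \<in> set A \<Longrightarrow> lvar x * P \<le> P" "x \<in> set A \<Longrightarrow> rvar x * P \<le> P"
begin

definition mismatch :: "'a tracks" where
  "mismatch = diagonal A * (off_diagonal A * P)"

text \<open>Up to mismatches, reading the queue \<open>s\<close> by \<open>F\<close> consumes the word \<open>u\<close> and leaves \<open>N\<close>.\<close>

definition reads :: "'a list \<Rightarrow> 'a tracks \<Rightarrow> 'a list \<Rightarrow> 'a tracks \<Rightarrow> bool" where
  "reads s F u N \<longleftrightarrow> rword s * F \<le> bword u * N + mismatch"

definition rejects :: "'a tracks \<Rightarrow> 'a \<Rightarrow> bool" where
  "rejects F x \<longleftrightarrow> (\<forall>s\<in>lists (set A). \<forall>u N. reads (x # s) F u N)"

lemma letter_mult_le_P: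
  assumes "x \<in> set A" "F \<le> P"
  shows "lvar x * F \<le> P" "rvar x * F \<le> P"
  using letter_mult_P_le[OF assms(1)] mult_left_mono[OF assms(2) zero_le] order_trans by blast+

lemma rword_mult_le_P: "s \<in> lists (set A) \<Longrightarrow> F \<le> P \<Longrightarrow> rword s * F \<le> P"
  by (induction s) (auto simp: mult.assoc intro: letter_mult_le_P)

lemma bword_mult_mismatch: "w \<in> lists (set A) \<Longrightarrow> bword w * (mismatch * F) \<le> mismatch * F"
  using bword_mult_diagonal_le unfolding mismatch_def by (simp add: mult.assoc)

lemma word_rel_mismatch: "(w, w @ v) \<notin> word_rel mismatch"
proof
  assume "(w, w @ v) \<in> word_rel mismatch"
  then obtain p x y u' v' where "w = p @ x # u'" "w @ v = p @ y # v'" "x \<noteq> y"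
    unfolding mismatch_def
    by (fastforce elim!: rel_concatE dest!: word_rel_diagonal word_rel_off_diagonal)
  then show False by simp
qed

lemma reads_rword: "reads s 1 [] (rword s)"
  by (simp add: reads_def add_upper1)

lemma reads_add: "reads s F u N \<Longrightarrow> reads s G u N \<Longrightarrow> reads s (F + G) u N"
  by (simp add: reads_def algebra_simps)

lemma reads_sum_list: "(\<And>F. F \<in> set Fs \<Longrightarrow> reads s F u N) \<Longrightarrow> reads s (sum_list Fs) u N"
  by (induction Fs) (auto simp: reads_add, simp add: reads_def)

lemma reads_rvar_mult: "reads (s @ [y]) F u N \<Longrightarrow> reads s (rvar y * F) u N"
  by (simp add: reads_def mult.assoc)

lemma reads_lvar_mult_same:
  assumes "x \<in> set A" "reads s F u N"
  shows "reads (x # s) (lvar x * F) (x # u) N"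
proof -
  have "rword (x # s) * (lvar x * F) = bvar x * (rword s * F)"
    by (rule rword_Cons_mult_lvar)
  also have "\<dots> \<le> bvar x * (bword u * N + mismatch)"
    using assms(2) unfolding reads_def by (intro mult_left_mono) auto
  also have "\<dots> \<le> bword (x # u) * N + mismatch"
    using bword_mult_mismatch[of "[x]" 1] assms(1)
    by (simp add: algebra_simps add_increasing add_increasing2)
  finally show ?thesis unfolding reads_def .
qed

lemma reads_lvar_mult_other:
  assumes "x \<in> set A" "y # s \<in> lists (set A)" "x \<noteq> y" "F \<le> P"
  shows "reads (y # s) (lvar x * F) u N"
proof -
  have "rword (y # s) * (lvar x * F) = lvar x * rvar y * (rword s * F)"
    by (rule rword_Cons_mult_lvar)
  also have "\<dots> \<le> off_diagonal A * P"
    using assms by (intro mult_mono lvar_rvar_le_off_diagonal rword_mult_le_P) auto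
  also have "\<dots> \<le> mismatch"
    unfolding mismatch_def by (rule le_mult_of_one_le[OF one_le_diagonal order_refl])
  finally show ?thesis unfolding reads_def by (rule add_increasing[OF zero_le])
qed

lemma reads_kstar_mult_other:
  assumes "x \<in> set A" "y # s \<in> lists (set A)" "x \<noteq> y" "kstar (bvar x) * F \<le> P"
    and "reads (y # s) F u N"
  shows "reads (y # s) (kstar (bvar x) * F) u N"
proof -
  have "reads (y # s) (lvar x * (rvar x * (kstar (bvar x) * F))) u N"
    using assms by (intro reads_lvar_mult_other letter_mult_le_P)
  with assms(5) have "reads (y # s) (F + bvar x * (kstar (bvar x) * F)) u N"
    by (intro reads_add) (simp_all add: mult.assoc)
  then show ?thesis by (simp flip: kstar_mult_unfold)
qed

lemma rejects_lvar_mult: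
  "x \<in> set A \<Longrightarrow> y \<in> set A \<Longrightarrow> x \<noteq> y \<Longrightarrow> F \<le> P \<Longrightarrow> rejects (lvar x * F) y"
  unfolding rejects_def by (intro ballI allI reads_lvar_mult_other) auto

lemma rejects_rvar_mult: "x \<in> set A \<Longrightarrow> rejects F y \<Longrightarrow> rejects (rvar x * F) y"
  unfolding rejects_def append_Cons[symmetric] by (fastforce intro!: reads_rvar_mult)

lemma rejects_kstar_mult:
  "x \<in> set A \<Longrightarrow> y \<in> set A \<Longrightarrow> x \<noteq> y \<Longrightarrow> kstar (bvar x) * F \<le> P \<Longrightarrow> rejects F y \<Longrightarrow>
    rejects (kstar (bvar x) * F) y"
  unfolding rejects_def by (intro ballI allI reads_kstar_mult_other) auto

lemma rejects_add: "rejects F x \<Longrightarrow> rejects G x \<Longrightarrow> rejects (F + G) x"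
  unfolding rejects_def by (blast intro: reads_add)

lemma rejectsD: "rejects F x \<Longrightarrow> s \<in> lists (set A) \<Longrightarrow> reads (x # s) F u N"
  by (simp add: rejects_def)

text \<open>Every letter that the loop reads from the front is written back at the end, hence the
  rotated queue in the last premise.\<close>

lemma reads_kstar_mult:
  assumes x: "x \<in> set A" and le_P: "kstar (bvar x) * F \<le> P" and rejects: "rejects F x"
    and v: "v \<in> lists (set A)" "v \<noteq> []" "hd v \<noteq> x"
    and rotated: "reads (v @ replicate n x) F u N"
  shows "reads (replicate n x @ v) (kstar (bvar x) * F) (replicate n x @ u) N"
  using v rotated
proof (induction n arbitrary: v)
  case 0
  then obtain y s where "v = y # s" by (cases v) auto
  with 0 x le_P show ?case by (auto intro!: reads_kstar_mult_other)
next
  case (Suc n)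
  let ?loop = "kstar (bvar x) * F"
  have "reads (replicate n x @ v @ [x]) ?loop (replicate n x @ u) N"
    using Suc.prems x by (intro Suc.IH) auto
  then have "reads (x # replicate n x @ v) (lvar x * (rvar x * ?loop)) (x # replicate n x @ u) N"
    using x by (intro reads_lvar_mult_same reads_rvar_mult) simp_all
  moreover have "reads (x # replicate n x @ v) F (x # replicate n x @ u) N"
    using Suc.prems x by (intro rejectsD[OF rejects]) auto
  ultimately have "reads (x # replicate n x @ v) (F + bvar x * ?loop) (x # replicate n x @ u) N"
    by (intro reads_add) (simp_all add: mult.assoc)
  then show ?case by (simp flip: kstar_mult_unfold)
qed

section \<open>Runs\<close>

text \<open>No word relates to its own extension under \<open>mismatch\<close>, so in the relational model only \<open>N\<close>
  can account for a step.\<close>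

lemma reads_step_in_word_rel:
  assumes "reads w R w N" and step: "lword w * rword w' \<le> R"
  shows "([], w') \<in> word_rel N"
proof -
  have "bword w * rword w' = rword w * (lword w * rword w')"
    by (simp add: mult.assoc flip: rword_lword)
  also have "\<dots> \<le> rword w * R" using step by (rule mult_left_mono) simp
  also have "\<dots> \<le> bword w * N + mismatch" using assms(1) unfolding reads_def .
  finally have "(w, w @ w') \<in> word_rel (bword w * N + mismatch)"
    using word_rel_mono by fastforce
  then show ?thesis using word_rel_mismatch by (auto simp: rel_concat_def)
qed

definition bound :: "'a tracks \<Rightarrow> 'a tracks \<Rightarrow> 'a tracks" where
  "bound T R = diagonal A * T + mismatch * kstar R"

lemma rword_mult_kstar_le_bound:
  assumes step: "reads w R w N" and w: "w \<in> lists (set A)" and "rword w \<le> T"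
    and N_le: "N * kstar R \<le> bound T R"
  shows "rword w * kstar R \<le> bound T R"
proof -
  have "rword w * R * kstar R \<le> (bword w * N + mismatch) * kstar R"
    using step unfolding reads_def by (rule mult_right_mono) simp
  also have "\<dots> = bword w * (N * kstar R) + mismatch * kstar R"
    by (simp add: algebra_simps)
  also have "\<dots> \<le> bword w * bound T R + bound T R"
    using N_le by (intro add_mono mult_left_mono) (simp_all add: bound_def add_upper2)
  also have "\<dots> \<le> bound T R"
    using bword_mult_diagonal_le[OF w] bword_mult_mismatch[OF w]
    unfolding bound_def
    by (auto simp: semiring_class.distrib_left intro: add_increasing add_increasing2)
  finally have "rword w * R * kstar R \<le> bound T R" .
  moreover have "rword w \<le> bound T R"
    using le_mult_of_one_le[OF one_le_diagonal \<open>rword w \<le> T\<close>] unfolding bound_def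
    by (rule add_increasing2[OF zero_le])
  ultimately show ?thesis by (subst kstar_unfold) (simp add: algebra_simps)
qed

theorem rword_mult_kstar_le_bound_if_run:
  assumes run: "(w, v) \<in> {(w, w'). lword w * rword w' \<le> R}\<^sup>*"
    and "w \<in> C" and lists: "C \<subseteq> lists (set A)"
    and successor: "\<And>w. w \<in> C \<Longrightarrow> \<exists>N\<in>insert 0 (rword ` C). reads w R w N"
    and covered: "\<And>w. w \<in> C \<Longrightarrow> reads w R w 0 \<or> rword w \<le> T"
    and halted: "reads v R v 0" "rword v \<le> T"
  shows "rword w * kstar R \<le> bound T R"
  using run \<open>w \<in> C\<close>
proof (induction rule: converse_rtrancl_induct)
  case base
  with halted lists show ?case by (intro rword_mult_kstar_le_bound) auto
next
  case (step w w')
  then have le: "lword w * rword w' \<le> R" by simp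
  obtain N where N: "N \<in> insert 0 (rword ` C)" "reads w R w N"
    using successor[OF step.prems] by blast
  have "N = rword w'" and "w' \<in> C"
    using N reads_step_in_word_rel[OF N(2) le] by auto
  moreover have "rword w \<le> T"
    using covered[OF step.prems] reads_step_in_word_rel[OF _ le, of 0] by auto
  ultimately show ?case
    using N(2) step lists by (intro rword_mult_kstar_le_bound) auto
qed

end

section \<open>Two-counter machines\<close>

lemma set_ktm_ksum [simp]: "set_ktm (ksum ts) = (\<Union>t\<in>set ts. set_ktm t)"
  by (induction ts) (auto simp: ksum_def)

lemma set_ktm_str_term [simp]: "set_ktm (str_term w) = set w"
  by (induction w) (auto simp: str_term_def)

lemma replicate_in_lists_iff [simp]: "replicate n x \<in> lists X \<longleftrightarrow> n = 0 \<or> x \<in> X"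
  by (induction n) auto

lemma trans_rel_discrete:
  "trans_rel (discrete_comset X) e = {({w}, {w'}) | w w'. w \<in> lists X \<and> w' \<in> lists X \<and>
     pka_le (ddot (discrete_comset X)) (lterm (str_term w) \<odot> rterm (str_term w')) e}"
proof -
  have "carr (discrete_comset X) = X" by (simp add: discrete_comset_def)
  then show ?thesis
    unfolding trans_rel_def by (simp add: str_class_discrete cong: rev_conj_cong)
qed

lemma rtrancl_trans_rel_discreteD:
  assumes "({w}, {v}) \<in> (trans_rel (discrete_comset X) e)\<^sup>*"
  shows "(w, v) \<in> {(w, w'). lword w * rword w' \<le> denot e}\<^sup>*"
  using assms
proof (induction "{w}" arbitrary: w rule: converse_rtrancl_induct)
  case (step c)
  then obtain w' where "c = {w'}" "lword w * rword w' \<le> denot e"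
    by (auto simp: trans_rel_discrete dest!: denot_le_if_pka_le)
  with step.hyps(3) show ?case by (auto intro: converse_rtrancl_into_rtrancl)
qed simp

definition factors :: "machine \<Rightarrow> sym dd ktm" where
  "factors M = ksum (map (\<lambda>x. vl x \<oplus> vr x) (sym_list M)) \<oplus>
     KStar (vl SymA \<odot> vr SymA) \<oplus> KStar (vl SymB \<odot> vr SymB)"

definition remainder :: "machine \<Rightarrow> sym dd ktm" where
  "remainder M = KStar (factors M) \<odot> KStar (RM M)"

definition config :: "nat \<Rightarrow> nat \<Rightarrow> sym \<Rightarrow> sym list" where
  "config i j z = replicate i SymA @ replicate j SymB @ [z]"

definition configs :: "machine \<Rightarrow> sym list set" where
  "configs M = {config i j (St q) | i j q. q \<in> states M} \<union> range (\<lambda>x. [SymC x])"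

fun successor :: "instruction \<Rightarrow> nat \<Rightarrow> nat \<Rightarrow> sym tracks" where
  "successor (Inc Reg1 q) i j = rword (config (Suc i) j (St q))"
| "successor (Inc Reg2 q) i j = rword (config i (Suc j) (St q))"
| "successor (IfZ Reg1 q1 q2) i j =
     (case i of 0 \<Rightarrow> rword (config 0 j (St q1)) | Suc k \<Rightarrow> rword (config k j (St q2)))"
| "successor (IfZ Reg2 q1 q2) i j =
     (case j of 0 \<Rightarrow> rword (config i 0 (St q1)) | Suc k \<Rightarrow> rword (config i k (St q2)))"
| "successor (Halt x) i j = (if i = 0 \<and> j = 0 then rword [SymC x] else 0)"

lemma successor_in_configs:
  "targets I \<subseteq> states M \<Longrightarrow> successor I i j \<in> insert 0 (rword ` configs M)"
  by (cases "(I, i, j)" rule: successor.cases)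
    (auto simp: configs_def simp del: word_simps split: nat.split)

lemma denot_Sig_star: "denot (Sig_star M) = diagonal (sym_list M)"
proof -
  have "denot (bterm (ksum (map Var xs))) = (\<Sum>x\<leftarrow>xs. bvar x)" for xs :: "sym list"
    by (induction xs) (auto simp: ksum_def bterm_def)
  then show ?thesis by (simp add: Sig_star_def bterm_def diagonal_def)
qed

lemma denot_Sig_neq: "denot (Sig_neq M) = off_diagonal (sym_list M)"
  by (simp add: Sig_neq_def off_diagonal_def denot_ksum map_concat comp_def if_distrib
      cong: if_cong)

lemma denot_RM:
  "denot (RM M) = (\<Sum>q\<leftarrow>state_list M. denot (instr_term (instr M q)) * lvar (St q))"
  by (simp add: RM_def denot_ksum comp_def)

lemma denot_rterm_CM:
  "denot (rterm (CM M)) =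
     kstar (rvar SymA) * kstar (rvar SymB) * (\<Sum>q\<leftarrow>state_list M. rvar (St q))"
proof -
  have "denot (rterm (ksum (map (\<lambda>q. Var (St q)) qs))) = (\<Sum>q\<leftarrow>qs. rvar (St q))" for qs
    by (induction qs) (auto simp: rterm_def ksum_def)
  then show ?thesis by (simp add: CM_def rterm_def)
qed

locale counter_machine =
  fixes M :: machine
  assumes machine: "two_counter_machine M"
begin

abbreviation \<Sigma> :: "sym set" where "\<Sigma> \<equiv> set (sym_list M)"

lemma finite_states [simp]: "finite (states M)"
  using machine by (simp add: two_counter_machine_def)

lemma targets_instr: "q \<in> states M \<Longrightarrow> targets (instr M q) \<subseteq> states M"
  using machine by (simp add: two_counter_machine_def)

lemma set_state_list [simp]: "set (state_list M) = states M"
  by (simp add: state_list_def)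

lemma Sig_eq: "Sig M = discrete_comset \<Sigma>"
  using set_sym_list[of M] by (simp add: Sig_def discrete_comset_def)

lemma mem_\<Sigma>_simps [simp]: "St q \<in> \<Sigma> \<longleftrightarrow> q \<in> states M" "SymA \<in> \<Sigma>" "SymB \<in> \<Sigma>" "SymC x \<in> \<Sigma>"
  by (cases x; auto simp: sym_list_def)+

abbreviation rest :: "sym tracks" where "rest \<equiv> kstar (denot (factors M))"

lemma letter_le_factors:
  assumes "x \<in> \<Sigma>"
  shows "lvar x \<le> denot (factors M)" "rvar x \<le> denot (factors M)"
proof -
  have "lvar x + rvar x \<le> (\<Sum>x\<leftarrow>sym_list M. lvar x + rvar x)"
    using assms by (intro member_le_sum_list) auto
  then show "lvar x \<le> denot (factors M)" "rvar x \<le> denot (factors M)"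
    by (auto simp: factors_def denot_ksum comp_def intro!: add_increasing2)
qed

sublocale queue "sym_list M" rest
  by unfold_locales (intro mult_le_kstar letter_le_factors order_refl; assumption)+

abbreviation a_loop :: "sym tracks" where "a_loop \<equiv> kstar (bvar SymA)"
abbreviation b_loop :: "sym tracks" where "b_loop \<equiv> kstar (bvar SymB)"

lemma loop_mult_le_rest:
  assumes "F \<le> rest"
  shows "a_loop * F \<le> rest" "b_loop * F \<le> rest"
  by (rule mult_le_kstar[OF _ assms], simp add: factors_def add_increasing add_increasing2)+

definition in_state :: "sym \<Rightarrow> nat \<Rightarrow> sym tracks \<Rightarrow> sym tracks" where
  "in_state z q N = (if z = St q then N else 0)"

abbreviation leave :: "sym \<Rightarrow> nat \<Rightarrow> sym tracks" where "leave y q \<equiv> rvar y * lvar (St q)"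

text \<open>The symbol \<open>z\<close> that ends the queue is a state or an output \<open>c\<^sub>x\<close>, so that one analysis covers
  running and halted configurations.\<close>

context
  fixes z :: sym and q :: nat
  assumes z: "z \<in> \<Sigma>" "z \<noteq> SymA" "z \<noteq> SymB" and q: "q \<in> states M"
begin

lemma leave_le_rest: "y \<in> \<Sigma> \<Longrightarrow> leave y q \<le> rest"
  using letter_mult_le_P(1)[OF _ one_le_kstar, of "St q"] q by (auto intro: letter_mult_le_P)

lemmas le_rest_intros = letter_mult_le_P loop_mult_le_rest leave_le_rest

lemma rejects_leave:
  assumes "x \<in> \<Sigma>" "y \<in> \<Sigma>" "x \<noteq> St q"
  shows "rejects (leave y q) x"
proof -
  have "rejects (lvar (St q) * 1) x"
    using assms q by (intro rejects_lvar_mult one_le_kstar) auto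
  then show ?thesis using assms by (auto intro: rejects_rvar_mult)
qed

lemma rejects_b_loop_leave:
  "x \<in> \<Sigma> \<Longrightarrow> y \<in> \<Sigma> \<Longrightarrow> x \<noteq> SymB \<Longrightarrow> x \<noteq> St q \<Longrightarrow> rejects (b_loop * leave y q) x"
  using q by (intro rejects_kstar_mult rejects_leave le_rest_intros) auto

lemma reads_leave:
  assumes "s \<in> lists \<Sigma>" "y \<in> \<Sigma>"
  shows "reads (z # s) (leave y q) [z] (in_state z q (rword (s @ [y])))"
proof (cases "z = St q")
  case True
  have "reads (St q # s @ [y]) (lvar (St q) * 1) [St q] (rword (s @ [y]))"
    using q by (intro reads_lvar_mult_same reads_rword) simp
  with True show ?thesis by (auto simp: in_state_def intro: reads_rvar_mult)
next
  case False
  with assms z show ?thesis by (intro rejectsD rejects_leave)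
qed

lemma reads_a_loop:
  assumes "rejects F SymA" "F \<le> rest" "s \<in> lists \<Sigma>"
    and "reads (replicate j SymB @ z # s @ replicate i SymA) F (replicate j SymB @ [z]) N"
  shows "reads (config i j z @ s) (a_loop * F) (config i j z) N"
proof -
  have "hd (replicate j SymB @ z # s) \<noteq> SymA" using z by (cases j) auto
  then have "reads (replicate i SymA @ replicate j SymB @ z # s) (a_loop * F)
      (replicate i SymA @ replicate j SymB @ [z]) N"
    using assms z by (intro reads_kstar_mult le_rest_intros) auto
  then show ?thesis by (simp add: config_def)
qed

lemma reads_b_loop_leave:
  assumes "s \<in> lists \<Sigma>" "y \<in> \<Sigma>"
  shows "reads (replicate j SymB @ z # s) (b_loop * leave y q) (replicate j SymB @ [z])
    (in_state z q (rword (s @ replicate j SymB @ [y])))"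
proof (rule reads_kstar_mult)
  show "reads ((z # s) @ replicate j SymB) (leave y q) [z]
      (in_state z q (rword (s @ replicate j SymB @ [y])))"
    using reads_leave[of "s @ replicate j SymB" y] assms by auto
qed (use assms z q in \<open>auto intro!: rejects_leave le_rest_intros\<close>)

lemma reads_loops_leave:
  assumes "s \<in> lists \<Sigma>" "y \<in> \<Sigma>"
  shows "reads (config i j z @ s) (a_loop * (b_loop * leave y q)) (config i j z)
    (in_state z q (rword (s @ config i j y)))"
proof (rule reads_a_loop)
  show "reads (replicate j SymB @ z # s @ replicate i SymA) (b_loop * leave y q)
      (replicate j SymB @ [z]) (in_state z q (rword (s @ config i j y)))"
    using reads_b_loop_leave[of "s @ replicate i SymA" y j] assms by (auto simp: config_def)
qed (use assms q in \<open>auto intro!: rejects_b_loop_leave le_rest_intros\<close>)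

lemma reads_Inc:
  assumes "q' \<in> states M"
  shows "reads (config i j z) (denot (instr_term (Inc r q')) * lvar (St q)) (config i j z)
    (in_state z q (successor (Inc r q') i j))"
proof (cases r)
  case Reg1
  have "reads (config i j z @ [SymA]) (a_loop * (b_loop * leave (St q') q)) (config i j z)
      (in_state z q (rword ([SymA] @ config i j (St q'))))"
    using assms by (intro reads_loops_leave) auto
  then have "reads (config i j z) (rvar SymA * (a_loop * (b_loop * leave (St q') q))) (config i j z)
      (in_state z q (rword ([SymA] @ config i j (St q'))))"
    by (rule reads_rvar_mult)
  then show ?thesis by (simp add: Reg1 config_def mult.assoc)
next
  case Reg2
  let ?write = "rvar SymB * (b_loop * leave (St q') q)"
  have "reads (replicate j SymB @ z # replicate i SymA @ [SymB]) (b_loop * leave (St q') q)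
      (replicate j SymB @ [z])
      (in_state z q (rword ((replicate i SymA @ [SymB]) @ replicate j SymB @ [St q'])))"
    using assms by (intro reads_b_loop_leave) auto
  then have "reads (config i j z @ []) (a_loop * ?write) (config i j z)
      (in_state z q (rword (config i (Suc j) (St q'))))"
    using assms q
    by (intro reads_a_loop reads_rvar_mult rejects_rvar_mult rejects_b_loop_leave le_rest_intros)
      (simp_all add: config_def)
  then show ?thesis by (simp add: Reg2 mult.assoc)
qed

lemma reads_IfZ_Reg1:
  assumes "q1 \<in> states M" "q2 \<in> states M"
  shows "reads (config i j z) (denot (instr_term (IfZ Reg1 q1 q2)) * lvar (St q)) (config i j z)
    (in_state z q (successor (IfZ Reg1 q1 q2) i j))"
proof -
  let ?zero = "b_loop * leave (St q1) q"
  let ?positive = "a_loop * (b_loop * leave (St q2) q)"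
  have "reads (config i j z) ?zero (config i j z) (in_state z q (successor (IfZ Reg1 q1 q2) i j))"
  proof (cases i)
    case 0
    then show ?thesis using reads_b_loop_leave[of "[]" "St q1" j] assms by (simp add: config_def)
  next
    case (Suc k)
    have "rejects ?zero SymA" using assms by (intro rejects_b_loop_leave) auto
    then show ?thesis using z by (auto simp: Suc config_def intro!: rejectsD)
  qed
  moreover have "reads (config i j z) (lvar SymA * ?positive) (config i j z)
      (in_state z q (successor (IfZ Reg1 q1 q2) i j))"
  proof (cases i)
    case 0
    obtain x s where "config i j z = x # s" "x # s \<in> lists \<Sigma>" "SymA \<noteq> x"
      using 0 z by (cases j) (auto simp: config_def)
    then show ?thesis using assms q by (auto intro!: reads_lvar_mult_other le_rest_intros)
  next
    case (Suc k)
    have "reads (config k j z @ []) ?positive (config k j z)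
        (in_state z q (rword ([] @ config k j (St q2))))"
      using assms by (intro reads_loops_leave) auto
    then have "reads (SymA # config k j z) (lvar SymA * ?positive) (SymA # config k j z)
        (in_state z q (rword (config k j (St q2))))"
      by (intro reads_lvar_mult_same) auto
    then show ?thesis by (simp add: Suc config_def)
  qed
  ultimately have "reads (config i j z) (?zero + lvar SymA * ?positive) (config i j z)
      (in_state z q (successor (IfZ Reg1 q1 q2) i j))"
    by (rule reads_add)
  then show ?thesis by (simp add: algebra_simps)
qed

lemma reads_b_test:
  assumes "s \<in> lists \<Sigma>" "q1 \<in> states M" "q2 \<in> states M"
  shows "reads (replicate j SymB @ z # s)
    (leave (St q1) q + lvar SymB * (b_loop * leave (St q2) q)) (replicate j SymB @ [z])
    (in_state z q (case j of 0 \<Rightarrow> rword (s @ [St q1])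
      | Suc k \<Rightarrow> rword (s @ replicate k SymB @ [St q2])))"
proof (cases j)
  case 0
  have "reads (z # s) (leave (St q1) q) [z] (in_state z q (rword (s @ [St q1])))"
    using assms by (intro reads_leave) auto
  moreover have "reads (z # s) (lvar SymB * (b_loop * leave (St q2) q)) [z]
      (in_state z q (rword (s @ [St q1])))"
    using assms q z by (auto intro!: reads_lvar_mult_other le_rest_intros)
  ultimately show ?thesis unfolding 0 by (simp add: reads_add del: word_simps)
next
  case (Suc k)
  let ?N = "in_state z q (rword (s @ replicate k SymB @ [St q2]))"
  have "rejects (leave (St q1) q) SymB" using assms by (intro rejects_leave) auto
  then have "reads (SymB # replicate k SymB @ z # s) (leave (St q1) q)
      (SymB # replicate k SymB @ [z]) ?N"
    using assms z by (intro rejectsD) auto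
  moreover have "reads (SymB # replicate k SymB @ z # s) (lvar SymB * (b_loop * leave (St q2) q))
      (SymB # replicate k SymB @ [z]) ?N"
    using assms by (intro reads_lvar_mult_same reads_b_loop_leave) auto
  ultimately show ?thesis unfolding Suc by (simp add: reads_add del: word_simps)
qed

lemma reads_IfZ_Reg2:
  assumes "q1 \<in> states M" "q2 \<in> states M"
  shows "reads (config i j z) (denot (instr_term (IfZ Reg2 q1 q2)) * lvar (St q)) (config i j z)
    (in_state z q (successor (IfZ Reg2 q1 q2) i j))"
proof -
  let ?test = "leave (St q1) q + lvar SymB * (b_loop * leave (St q2) q)"
  have "reads (config i j z @ []) (a_loop * ?test) (config i j z)
    (in_state z q (case j of 0 \<Rightarrow> rword (replicate i SymA @ [St q1])
      | Suc k \<Rightarrow> rword (replicate i SymA @ replicate k SymB @ [St q2])))"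
  proof (rule reads_a_loop)
    show "rejects ?test SymA"
      using assms q
      by (intro rejects_add rejects_leave rejects_lvar_mult loop_mult_le_rest leave_le_rest) auto
    show "?test \<le> rest"
      using assms q by (auto intro!: le_rest_intros)
  qed (use reads_b_test[of "replicate i SymA"] assms in auto)
  moreover have "denot (instr_term (IfZ Reg2 q1 q2)) * lvar (St q) = a_loop * ?test"
    by (simp add: algebra_simps)
  ultimately show ?thesis by (cases j) (simp_all add: config_def)
qed

lemma reads_Halt:
  "reads (config i j z) (denot (instr_term (Halt x)) * lvar (St q)) (config i j z)
    (in_state z q (successor (Halt x) i j))"
proof (cases "i = 0 \<and> j = 0")
  case True
  then show ?thesis using reads_leave[of "[]" "SymC x"] by (simp add: config_def)
next
  case False
  then obtain y s where ys: "config i j z = y # s" "y \<in> \<Sigma>" "s \<in> lists \<Sigma>" "y \<noteq> St q"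
    using z by (cases i; cases j) (auto simp: config_def)
  then have "reads (y # s) (leave (SymC x) q) (config i j z)
      (in_state z q (successor (Halt x) i j))"
    by (intro rejectsD rejects_leave) auto
  then show ?thesis by (simp add: ys(1))
qed

lemma reads_instr:
  assumes "targets I \<subseteq> states M"
  shows "reads (config i j z) (denot (instr_term I) * lvar (St q)) (config i j z)
    (in_state z q (successor I i j))"
proof (cases I)
  case (Inc r q')
  with assms have "q' \<in> states M" by simp
  then show ?thesis unfolding Inc by (rule reads_Inc)
next
  case (IfZ r q1 q2)
  with assms have states: "q1 \<in> states M" "q2 \<in> states M" by simp_all
  show ?thesis
  proof (cases r)
    case Reg1
    show ?thesis unfolding IfZ Reg1 using states by (rule reads_IfZ_Reg1)
  next
    case Reg2
    show ?thesis unfolding IfZ Reg2 using states by (rule reads_IfZ_Reg2)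
  qed
next
  case (Halt x)
  show ?thesis unfolding Halt by (rule reads_Halt)
qed

end

lemma reads_RM_if_reads_instr:
  assumes "\<And>q. q \<in> states M \<Longrightarrow> reads s (denot (instr_term (instr M q)) * lvar (St q)) u N"
  shows "reads s (denot (RM M)) u N"
  unfolding denot_RM by (rule reads_sum_list) (use assms in auto)

lemma reads_RM:
  assumes "q \<in> states M"
  shows "reads (config i j (St q)) (denot (RM M)) (config i j (St q)) (successor (instr M q) i j)"
proof (rule reads_RM_if_reads_instr)
  fix q' assume "q' \<in> states M"
  then have "reads (config i j (St q)) (denot (instr_term (instr M q')) * lvar (St q'))
      (config i j (St q)) (in_state (St q) q' (successor (instr M q') i j))"
    using assms by (intro reads_instr targets_instr) auto
  then show "reads (config i j (St q)) (denot (instr_term (instr M q')) * lvar (St q'))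
      (config i j (St q)) (successor (instr M q) i j)"
    by (cases "q = q'") (auto simp: in_state_def reads_def intro: add_increasing)
qed

lemma reads_RM_halted: "reads [SymC x] (denot (RM M)) [SymC x] 0"
proof (rule reads_RM_if_reads_instr)
  fix q assume "q \<in> states M"
  then show "reads [SymC x] (denot (instr_term (instr M q)) * lvar (St q)) [SymC x] 0"
    using reads_instr[of "SymC x" q "instr M q" 0 0] targets_instr[of q]
    by (simp add: config_def in_state_def)
qed

lemma configs_subset: "configs M \<subseteq> lists \<Sigma>"
  by (auto simp: configs_def config_def)

lemma configs_cases:
  assumes "w \<in> configs M"
  obtains (running) i j q where "w = config i j (St q)" "q \<in> states M"
  | (halted) x where "w = [SymC x]"
  using assms unfolding configs_def by blast

lemma config_le_rterm_CM:
  assumes "q \<in> states M"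
  shows "rword (config i j (St q)) \<le> denot (rterm (CM M))"
proof -
  have "rvar (St q) \<le> (\<Sum>q\<leftarrow>state_list M. rvar (St q))"
    using assms by (intro member_le_sum_list) auto
  then have "rword (replicate i SymA) * rword (replicate j SymB) * rvar (St q) \<le>
      denot (rterm (CM M))"
    unfolding denot_rterm_CM by (intro mult_mono rword_replicate_le_kstar) auto
  then show ?thesis by (simp add: config_def mult.assoc)
qed

lemma word_in_configs:
  assumes "pka_le (Sig M) (str_term w) (TM M)"
  shows "w \<in> configs M"
proof -
  have "rword w \<le> denot (rterm (TM M))"
    using denot_rterm_le_if_pka_le[OF assms[unfolded Sig_eq]] by simp
  also have "denot (rterm (TM M)) = denot (rterm (CM M)) + rvar (SymC False) + rvar (SymC True)"
    by (simp add: TM_def rterm_def)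
  finally have "word_rel (rword w) \<subseteq>
      word_rel (denot (rterm (CM M)) + rvar (SymC False) + rvar (SymC True))"
    by (rule word_rel_mono)
  then consider "([], w) \<in> word_rel (denot (rterm (CM M)))" | x where "w = [SymC x]"
    by auto
  then show ?thesis
  proof cases
    case 1
    then obtain i j q where "q \<in> states M"
      and "w = (replicate i SymA @ replicate j SymB) @ [St q]"
      unfolding denot_rterm_CM word_rel_simps rel_star_singleton_right word_rel_sum_list
      by (elim rel_concatE) auto
    then show ?thesis by (auto simp: configs_def config_def)
  next
    case (2 x)
    then show ?thesis by (auto simp: configs_def)
  qed
qed

lemma rword_mult_kstar_RM_le_bound:
  assumes "w \<in> configs M"
    and "(w, [SymC True]) \<in> {(w, w'). lword w * rword w' \<le> denot (RM M)}\<^sup>*"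
  shows "rword w * kstar (denot (RM M)) \<le>
    bound (denot (rterm (CM M \<oplus> Var (SymC True)))) (denot (RM M))"
proof (rule rword_mult_kstar_le_bound_if_run[OF assms(2,1) configs_subset])
  have rterm_eq: "denot (rterm (CM M \<oplus> Var (SymC True))) = denot (rterm (CM M)) + rvar (SymC True)"
    by (simp add: rterm_def)
  show "\<exists>N\<in>insert 0 (rword ` configs M). reads w (denot (RM M)) w N" if "w \<in> configs M" for w
    using that
  proof (cases rule: configs_cases)
    case (running i j q)
    then show ?thesis
      using reads_RM[of q i j] successor_in_configs[OF targets_instr[of q], of i j] by auto
  next
    case (halted x)
    then show ?thesis using reads_RM_halted[of x] by auto
  qed
  show "reads w (denot (RM M)) w 0 \<or> rword w \<le> denot (rterm (CM M \<oplus> Var (SymC True)))"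
    if "w \<in> configs M" for w
    using that
    by (cases rule: configs_cases)
      (simp_all add: rterm_eq reads_RM_halted config_le_rterm_CM add_increasing2)
  show "reads [SymC True] (denot (RM M)) [SymC True] 0" by (rule reads_RM_halted)
  show "rword [SymC True] \<le> denot (rterm (CM M \<oplus> Var (SymC True)))"
    by (simp add: rterm_eq add_upper2)
qed

lemma in_terms_iff: "t \<in> terms (ddot (Sig M)) \<longleftrightarrow> set_ktm t \<subseteq> Lft ` \<Sigma> \<union> Rgt ` \<Sigma>"
  by (simp add: terms_def ddot_def Sig_eq discrete_comset_def)

lemma rterm_in_terms: "set_ktm t \<subseteq> \<Sigma> \<Longrightarrow> rterm t \<in> terms (ddot (Sig M))"
  by (auto simp: in_terms_iff rterm_def)

lemma set_ktm_instr_term: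
  "targets I \<subseteq> states M \<Longrightarrow> set_ktm (instr_term I) \<subseteq> Lft ` \<Sigma> \<union> Rgt ` \<Sigma>"
  by (cases I rule: instr_term.cases) auto

lemma RM_in_terms: "RM M \<in> terms (ddot (Sig M))"
  using set_ktm_instr_term[OF targets_instr] by (auto simp: in_terms_iff RM_def)

lemma remainder_in_terms: "remainder M \<in> terms (ddot (Sig M))"
  using RM_in_terms by (auto simp: in_terms_iff remainder_def factors_def)

lemma bound_in_terms:
  "Sig_star M \<odot> rterm (CM M \<oplus> Var (SymC True)) \<oplus> Sig_star M \<odot> Sig_neq M \<odot> remainder M
    \<in> terms (ddot (Sig M))"
proof -
  have "Sig_star M \<in> terms (ddot (Sig M))" "Sig_neq M \<in> terms (ddot (Sig M))"
    by (auto simp: in_terms_iff Sig_star_def Sig_neq_def bterm_def split: if_splits)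
  moreover have "rterm (CM M \<oplus> Var (SymC True)) \<in> terms (ddot (Sig M))"
    by (rule rterm_in_terms) (auto simp: CM_def)
  ultimately show ?thesis using remainder_in_terms by (auto simp: in_terms_iff)
qed

theorem halting_inequality:
  assumes w: "w \<in> lists (carr (Sig M))" "pka_le (Sig M) (str_term w) (TM M)"
    and run: "(str_class (Sig M) w, str_class (Sig M) [SymC True]) \<in> (trans_rel (Sig M) (RM M))\<^sup>*"
  shows "pka_le (ddot (Sig M)) (rterm (str_term w) \<odot> KStar (RM M))
    (Sig_star M \<odot> rterm (CM M \<oplus> Var (SymC True)) \<oplus> Sig_star M \<odot> Sig_neq M \<odot> remainder M)"
proof -
  have w_\<Sigma>: "w \<in> lists \<Sigma>" using w(1) by (simp add: Sig_eq discrete_comset_def)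
  then have "({w}, {[SymC True]}) \<in> (trans_rel (discrete_comset \<Sigma>) (RM M))\<^sup>*"
    using run by (simp add: Sig_eq str_class_discrete)
  then have "(w, [SymC True]) \<in> {(w, w'). lword w * rword w' \<le> denot (RM M)}\<^sup>*"
    by (rule rtrancl_trans_rel_discreteD)
  with word_in_configs[OF w(2)] have "rword w * kstar (denot (RM M)) \<le>
      bound (denot (rterm (CM M \<oplus> Var (SymC True)))) (denot (RM M))"
    by (rule rword_mult_kstar_RM_le_bound)
  then have "denot (rterm (str_term w) \<odot> KStar (RM M)) \<le> denot
      (Sig_star M \<odot> rterm (CM M \<oplus> Var (SymC True)) \<oplus> Sig_star M \<odot> Sig_neq M \<odot> remainder M)"
    by (simp add: denot_Sig_star denot_Sig_neq bound_def mismatch_def remainder_def mult.assoc)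
  moreover have "rterm (str_term w) \<odot> KStar (RM M) \<in> terms (ddot (Sig M))"
    using rterm_in_terms[of "str_term w"] w_\<Sigma> RM_in_terms by (auto simp: in_terms_iff)
  ultimately show ?thesis
    using bound_in_terms unfolding Sig_eq by (rule pka_le_if_denot_le)
qed

end

section \<open>Computability\<close>

definition recursive :: "(nat \<Rightarrow> nat) \<Rightarrow> bool" where
  "recursive h \<longleftrightarrow> partial_recursive (\<lambda>n. Some (h n))"

lemma recursive_prod_decode:
  "recursive (\<lambda>n. fst (prod_decode n))" "recursive (\<lambda>n. snd (prod_decode n))"
  unfolding recursive_def by (rule pr_fst pr_snd)+

lemma recursive_Suc: "recursive Suc"
  unfolding recursive_def by (rule pr_succ)

lemma recursive_comp: "recursive f \<Longrightarrow> recursive g \<Longrightarrow> recursive (\<lambda>n. f (g n))"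
  unfolding recursive_def by (drule (1) pr_comp) simp

lemma recursive_prod_encode:
  "recursive f \<Longrightarrow> recursive g \<Longrightarrow> recursive (\<lambda>n. prod_encode (f n, g n))"
  unfolding recursive_def by (drule (1) pr_pair) simp

lemma recursive_id: "recursive (\<lambda>n. n)"
  using recursive_prod_encode[OF recursive_prod_decode] by simp

lemmas recursive_fst_snd = recursive_prod_decode[THEN recursive_comp]

lemma recursive_const: "recursive (\<lambda>n. c)"
proof (induction c)
  case 0
  show ?case unfolding recursive_def by (rule pr_zero)
next
  case (Suc c)
  show ?case using recursive_comp[OF recursive_Suc Suc] .
qed

lemma recursive_rec_nat:
  assumes "recursive b" "recursive c" "recursive m"
  shows "recursive (\<lambda>n. rec_nat (b n) (\<lambda>k r. c (prod_encode (n, prod_encode (k, r)))) (m n))"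
proof -
  have rec_nat_Some:
    "rec_nat (Some x) (\<lambda>k r. Option.bind r (\<lambda>i. Some (g k i))) m = Some (rec_nat x g m)"
    for x :: nat and g m by (induction m) auto
  have "recursive (\<lambda>n. rec_nat (b (fst (prod_decode n)))
      (\<lambda>k r. c (prod_encode (fst (prod_decode n), prod_encode (k, r)))) (snd (prod_decode n)))"
    using pr_prec[OF assms(1,2)[unfolded recursive_def]] unfolding recursive_def rec_nat_Some .
  from recursive_comp[OF this recursive_prod_encode[OF recursive_id assms(3)]]
  show ?thesis by simp
qed

lemma recursive_funpow:
  assumes "recursive f" "recursive g" "recursive m"
  shows "recursive (\<lambda>n. (f ^^ m n) (g n))"
proof -
  have "rec_nat x (\<lambda>k. f) k = (f ^^ k) x" for x k by (induction k) auto
  with recursive_rec_nat[OF assms(2) recursive_comp[OF assms(1) recursive_fst_snd(2)[OF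
    recursive_prod_decode(2)]] assms(3)]
  show ?thesis by simp
qed

lemma recursive_pred:
  assumes "recursive m"
  shows "recursive (\<lambda>n. m n - 1)"
proof -
  have "rec_nat 0 (\<lambda>k r. k) k = k - 1" for k :: nat by (cases k) auto
  with recursive_rec_nat[OF recursive_const[of 0]
      recursive_fst_snd(1)[OF recursive_prod_decode(2)] assms]
  show ?thesis by simp
qed

lemma recursive_if_zero:
  assumes "recursive m" "recursive f" "recursive g"
  shows "recursive (\<lambda>n. if m n = 0 then f n else g n)"
proof -
  have "rec_nat x (\<lambda>k r. y) k = (if k = 0 then x else y)" for k and x y :: nat by (cases k) auto
  with recursive_rec_nat[OF assms(2) recursive_comp[OF assms(3) recursive_prod_decode(1)] assms(1)]
  show ?thesis by simp
qed

lemmas recursive_intros = recursive_prod_encode recursive_fst_snd recursive_pred recursive_if_zero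
  recursive_id recursive_const

lemma length_le_list_encode: "length xs \<le> list_encode xs"
proof (induction xs)
  case (Cons x xs)
  then show ?case using le_prod_encode_2[of "list_encode xs" x] by simp
qed simp

text \<open>The loop state is an accumulator paired with the code of the remaining list; that code bounds
  the number of iterations.\<close>

lemma recursive_fold:
  assumes "recursive b" "recursive c" "recursive l"
  shows "recursive (\<lambda>n. fold (\<lambda>x acc. c (prod_encode (x, acc))) (list_decode (l n)) (b n))"
proof -
  let ?fst = "\<lambda>n. fst (prod_decode n)" and ?snd = "\<lambda>n. snd (prod_decode n)"
  let ?fold = "fold (\<lambda>x acc. c (prod_encode (x, acc)))"
  define step where "step p = (if ?snd p = 0 then p else
    prod_encode (c (prod_encode (?fst (?snd p - 1), ?fst p)), ?snd (?snd p - 1)))" for p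
  have "recursive step"
    unfolding step_def by (intro recursive_intros recursive_comp[OF assms(2)])
  then have "recursive (\<lambda>n. ?fst ((step ^^ l n) (prod_encode (b n, l n))))"
    by (intro recursive_fst_snd recursive_funpow recursive_prod_encode assms)
  moreover have "?fst ((step ^^ k) (prod_encode (acc, list_encode xs))) = ?fold xs acc"
    if "length xs \<le> k" for k acc xs
    using that
  proof (induction k arbitrary: acc xs)
    case (Suc k)
    show ?case
    proof (cases xs)
      case Nil
      have "step (prod_encode (acc, 0)) = prod_encode (acc, 0)" by (simp add: step_def)
      with Suc.IH[of "[]" acc] show ?thesis by (simp add: Nil funpow_Suc_right del: funpow.simps)
    next
      case (Cons y ys)
      then have "step (prod_encode (acc, list_encode xs)) =
          prod_encode (c (prod_encode (y, acc)), list_encode ys)"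
        by (simp add: step_def)
      with Suc Cons show ?thesis by (simp add: funpow_Suc_right del: funpow.simps)
    qed
  qed simp
  then have "?fst ((step ^^ k) (prod_encode (acc, k))) = ?fold (list_decode k) acc" for k acc
    using length_le_list_encode[of "list_decode k"] by (metis list_decode_inverse)
  ultimately show ?thesis by simp
qed

lemma recursive_foldr:
  assumes "recursive b" "recursive c" "recursive l"
  shows "recursive (\<lambda>n. foldr (\<lambda>x acc. c (prod_encode (x, acc))) (list_decode (l n)) (b n))"
proof -
  have "fold (\<lambda>x acc. Suc (prod_encode (x, acc))) xs (list_encode ys) = list_encode (rev xs @ ys)"
    for xs ys by (induction xs arbitrary: ys) (simp_all flip: list_encode.simps)
  from this[of _ "[]"] have "recursive (\<lambda>n. list_encode (rev (list_decode (l n))))"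
    using recursive_fold[OF recursive_const[of 0] recursive_Suc assms(3)] by simp
  from recursive_fold[OF assms(1,2) this] show ?thesis by (simp add: foldr_conv_fold)
qed

definition computable :: "('a \<Rightarrow> nat) \<Rightarrow> ('b \<Rightarrow> nat) \<Rightarrow> ('a \<Rightarrow> 'b) \<Rightarrow> bool" where
  "computable c d F \<longleftrightarrow> (\<exists>h. recursive h \<and> (\<forall>x. h (c x) = d (F x)))"

definition pair_code :: "('a \<Rightarrow> nat) \<Rightarrow> ('b \<Rightarrow> nat) \<Rightarrow> 'a \<times> 'b \<Rightarrow> nat" where
  "pair_code c d p = prod_encode (c (fst p), d (snd p))"

definition list_code :: "('a \<Rightarrow> nat) \<Rightarrow> 'a list \<Rightarrow> nat" where
  "list_code c xs = list_encode (map c xs)"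

lemma computableI: "recursive h \<Longrightarrow> (\<And>x. h (c x) = d (F x)) \<Longrightarrow> computable c d F"
  unfolding computable_def by blast

lemma computable_ident: "computable c c (\<lambda>x. x)"
  by (rule computableI[OF recursive_id]) simp

lemma computable_const: "computable c d (\<lambda>x. y)"
  by (rule computableI[OF recursive_const]) simp

lemma computable_comp:
  assumes "computable d e G" "computable c d F"
  shows "computable c e (\<lambda>x. G (F x))"
proof -
  obtain g where g: "recursive g" "\<And>y. g (d y) = e (G y)"
    using assms(1) unfolding computable_def by blast
  obtain f where f: "recursive f" "\<And>x. f (c x) = d (F x)"
    using assms(2) unfolding computable_def by blast
  show ?thesis by (rule computableI[OF recursive_comp[OF g(1) f(1)]]) (simp add: f g)
qed

lemma computable_Pair:
  assumes "computable c d F" "computable c e G"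
  shows "computable c (pair_code d e) (\<lambda>x. (F x, G x))"
proof -
  obtain f where f: "recursive f" "\<And>x. f (c x) = d (F x)"
    using assms(1) unfolding computable_def by blast
  obtain g where g: "recursive g" "\<And>x. g (c x) = e (G x)"
    using assms(2) unfolding computable_def by blast
  show ?thesis
    by (rule computableI[OF recursive_prod_encode[OF f(1) g(1)]]) (simp add: f g pair_code_def)
qed

lemma computable_fst: "computable c (pair_code d e) F \<Longrightarrow> computable c d (\<lambda>x. fst (F x))"
  by (erule computable_comp[rotated], rule computableI[OF recursive_prod_decode(1)])
    (simp add: pair_code_def)

lemma computable_snd: "computable c (pair_code d e) F \<Longrightarrow> computable c e (\<lambda>x. snd (F x))"
  by (erule computable_comp[rotated], rule computableI[OF recursive_prod_decode(2)])
    (simp add: pair_code_def)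

lemma computable_foldr:
  assumes "computable c d B" "computable c (list_code e) L"
    and "computable (pair_code e d) d (\<lambda>p. f (fst p) (snd p))"
  shows "computable c d (\<lambda>x. foldr f (L x) (B x))"
proof -
  obtain b where b: "recursive b" "\<And>x. b (c x) = d (B x)"
    using assms(1) unfolding computable_def by blast
  obtain l where l: "recursive l" "\<And>x. l (c x) = list_code e (L x)"
    using assms(2) unfolding computable_def by blast
  obtain s where s: "recursive s" "\<And>p. s (pair_code e d p) = d (f (fst p) (snd p))"
    using assms(3) unfolding computable_def by blast
  have "foldr (\<lambda>x acc. s (prod_encode (x, acc))) (map e ys) (d r) = d (foldr f ys r)" for ys r
    using s(2)[of "(_, _)"] by (induction ys) (simp_all add: pair_code_def)
  then show ?thesis
    by (intro computableI[OF recursive_foldr[OF b(1) s(1) l(1)]]) (simp add: b l list_code_def)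
qed

lemma computable_tagged:
  assumes "computable c d F" "\<And>x. code (G x) = prod_encode (k, d (F x))"
  shows "computable c code G"
proof -
  obtain f where f: "recursive f" "\<And>x. f (c x) = d (F x)"
    using assms(1) unfolding computable_def by blast
  show ?thesis
    by (rule computableI[OF recursive_prod_encode[OF recursive_const f(1)]]) (simp add: f assms(2))
qed

lemma computable_tag_cases:
  assumes "computable c\<^sub>0 d F\<^sub>0" "computable c\<^sub>1 d F\<^sub>1" "computable c\<^sub>2 d F\<^sub>2"
    and tags: "\<And>x. (\<exists>y. code x = prod_encode (0, c\<^sub>0 y) \<and> G x = F\<^sub>0 y) \<or>
      (\<exists>y. code x = prod_encode (1, c\<^sub>1 y) \<and> G x = F\<^sub>1 y) \<or>
      (\<exists>y. code x = prod_encode (2, c\<^sub>2 y) \<and> G x = F\<^sub>2 y)"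
  shows "computable code d G"
proof -
  let ?fst = "\<lambda>n. fst (prod_decode n)" and ?snd = "\<lambda>n. snd (prod_decode n)"
  obtain f\<^sub>0 where f\<^sub>0: "recursive f\<^sub>0" "\<And>y. f\<^sub>0 (c\<^sub>0 y) = d (F\<^sub>0 y)"
    using assms(1) unfolding computable_def by blast
  obtain f\<^sub>1 where f\<^sub>1: "recursive f\<^sub>1" "\<And>y. f\<^sub>1 (c\<^sub>1 y) = d (F\<^sub>1 y)"
    using assms(2) unfolding computable_def by blast
  obtain f\<^sub>2 where f\<^sub>2: "recursive f\<^sub>2" "\<And>y. f\<^sub>2 (c\<^sub>2 y) = d (F\<^sub>2 y)"
    using assms(3) unfolding computable_def by blast
  let ?h = "\<lambda>n. if ?fst n = 0 then f\<^sub>0 (?snd n)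
    else if ?fst n - 1 = 0 then f\<^sub>1 (?snd n) else f\<^sub>2 (?snd n)"
  have "recursive ?h"
    by (intro recursive_intros recursive_comp[OF f\<^sub>0(1)] recursive_comp[OF f\<^sub>1(1)]
        recursive_comp[OF f\<^sub>2(1)])
  moreover have "?h (code x) = d (G x)" for x
    using tags[of x] by (auto simp: f\<^sub>0 f\<^sub>1 f\<^sub>2)
  ultimately show ?thesis by (rule computableI)
qed

lemma computable_term_constructors:
  assumes "computable c term_code F"
  shows "computable c term_code (\<lambda>x. KStar (F x))"
    and "computable c term_code G \<Longrightarrow> computable c term_code (\<lambda>x. F x \<oplus> G x)"
    and "computable c term_code G \<Longrightarrow> computable c term_code (\<lambda>x. F x \<odot> G x)"
  by (rule computable_tagged[OF assms] computable_tagged[OF computable_Pair[OF assms]],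
      assumption?, simp add: pair_code_def)+

lemma computable_Var:
  assumes "computable c sym_code F"
  shows "computable c term_code (\<lambda>x. vl (F x))" "computable c term_code (\<lambda>x. vr (F x))"
proof -
  have "computable c dd_code (\<lambda>x. Lft (F x))" "computable c dd_code (\<lambda>x. Rgt (F x))"
    by (rule computable_tagged[OF assms], simp)+
  then show "computable c term_code (\<lambda>x. vl (F x))" "computable c term_code (\<lambda>x. vr (F x))"
    by - (erule computable_tagged, simp)+
qed

lemma computable_sym_constructors:
  "computable c id F \<Longrightarrow> computable c sym_code (\<lambda>x. St (F x))"
  "computable c of_bool F' \<Longrightarrow> computable c sym_code (\<lambda>x. SymC (F' x))"
  by (erule computable_tagged, simp)+

lemmas computable_intros = computable_ident computable_const computable_fst computable_snd
  computable_term_constructors computable_Var computable_sym_constructors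

lemma computable_counter_cases:
  assumes "computable c d (\<lambda>x. F (Reg1, x))" "computable c d (\<lambda>x. F (Reg2, x))"
  shows "computable (pair_code counter_code c) d F"
  using assms(1,2,2)
proof (rule computable_tag_cases)
  fix p :: "counter \<times> 'a"
  obtain r x where "p = (r, x)" by (cases p)
  then show "(\<exists>y. pair_code counter_code c p = prod_encode (0, c y) \<and> F p = F (Reg1, y)) \<or>
      (\<exists>y. pair_code counter_code c p = prod_encode (1, c y) \<and> F p = F (Reg2, y)) \<or>
      (\<exists>y. pair_code counter_code c p = prod_encode (2, c y) \<and> F p = F (Reg2, y))"
    by (cases r) (auto simp: pair_code_def)
qed

lemma computable_instr_term: "computable instr_code term_code instr_term"
proof (rule computable_tag_cases)
  show "computable (pair_code counter_code id) term_code (\<lambda>(r, q). instr_term (Inc r q))"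
    by (rule computable_counter_cases; simp; (rule computable_intros)+)
  show "computable (pair_code counter_code (pair_code id id)) term_code
      (\<lambda>(r, p). instr_term (IfZ r (fst p) (snd p)))"
    by (rule computable_counter_cases; simp; (rule computable_intros)+)
  show "computable of_bool term_code (\<lambda>x. instr_term (Halt x))"
    by simp (rule computable_intros)+
  show "(\<exists>y. instr_code I = prod_encode (0, pair_code counter_code id y) \<and>
        instr_term I = (case y of (r, q) \<Rightarrow> instr_term (Inc r q))) \<or>
      (\<exists>y. instr_code I = prod_encode (1, pair_code counter_code (pair_code id id) y) \<and>
        instr_term I = (case y of (r, p) \<Rightarrow> instr_term (IfZ r (fst p) (snd p)))) \<or>
      (\<exists>y. instr_code I = prod_encode (2, of_bool y) \<and> instr_term I = instr_term (Halt y))" for I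
    by (cases I) (auto simp: pair_code_def)
qed

definition program :: "machine \<Rightarrow> (nat \<times> instruction) list" where
  "program M = map (\<lambda>q. (q, instr M q)) (state_list M)"

lemma computable_program:
  "computable (\<lambda>(M, w). input_code M w) (list_code (pair_code id instr_code)) (\<lambda>x. program (fst x))"
proof (rule computableI)
  show "recursive (\<lambda>n. snd (prod_decode (fst (prod_decode n))))"
    by (intro recursive_intros)
qed (auto simp: input_code_def machine_code_def program_def list_code_def pair_code_def comp_def)

lemma computable_foldr_program:
  assumes "computable (pair_code id instr_code) term_code F"
  shows "computable (\<lambda>(M, w). input_code M w) term_code
    (\<lambda>x. foldr (\<lambda>y t. F y \<oplus> t) (program (fst x)) t)"
  by (rule computable_foldr[OF computable_const computable_program] computable_comp[OF assms]
      computable_intros)+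

lemma computable_remainder:
  "computable (\<lambda>(M, w). input_code M w) term_code (\<lambda>x. remainder (fst x))"
proof -
  have RM: "RM M = foldr (\<lambda>y t. instr_term (snd y) \<odot> vl (St (fst y)) \<oplus> t) (program M) KZero" for M
    by (simp add: RM_def ksum_def program_def foldr_map comp_def)
  have letters: "ksum (map (\<lambda>x. vl x \<oplus> vr x) (sym_list M)) =
      foldr (\<lambda>y t. (vl (St (fst y)) \<oplus> vr (St (fst y))) \<oplus> t) (program M)
        (ksum (map (\<lambda>x. vl x \<oplus> vr x) [SymA, SymB, SymC False, SymC True]))" for M
    by (simp add: sym_list_def ksum_def program_def foldr_map comp_def)
  show ?thesis
    unfolding remainder_def factors_def RM letters
    by (rule computable_foldr_program computable_comp[OF computable_instr_term] computable_intros)+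
qed

theorem mainTheorem3:
  shows "\<exists>\<rho> :: machine \<Rightarrow> sym list \<Rightarrow> sym dd ktm.
    (\<exists>f. partial_recursive f \<and>
      (\<forall>M w. two_counter_machine M \<longrightarrow> w \<in> lists (carr (Sig M)) \<longrightarrow>
        pka_le (Sig M) (str_term w) (TM M) \<longrightarrow>
        f (input_code M w) = Some (term_code (\<rho> M w)))) \<and>
    (\<forall>M w. two_counter_machine M \<longrightarrow> w \<in> lists (carr (Sig M)) \<longrightarrow>
      pka_le (Sig M) (str_term w) (TM M) \<longrightarrow>
      \<rho> M w \<in> terms (ddot (Sig M)) \<and>
      ((str_class (Sig M) w, str_class (Sig M) [SymC True]) \<in> (trans_rel (Sig M) (RM M))\<^sup>* \<longrightarrow>
        pka_le (ddot (Sig M))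
          (rterm (str_term w) \<odot> KStar (RM M))
          (Sig_star M \<odot> rterm (CM M \<oplus> Var (SymC True)) \<oplus> Sig_star M \<odot> Sig_neq M \<odot> \<rho> M w)))"
proof -
  let ?\<rho> = "\<lambda>M (w :: sym list). remainder M"
  obtain h where h: "recursive h" "\<And>M w. h (input_code M w) = term_code (?\<rho> M w)"
    using computable_remainder unfolding computable_def by fastforce
  have "counter_machine M" if "two_counter_machine M" for M
    using that by unfold_locales
  note remainder_in_terms = counter_machine.remainder_in_terms[OF this]
    and halting_inequality = counter_machine.halting_inequality[OF this]
  show ?thesis
  proof (intro exI[of _ ?\<rho>] conjI exI[of _ "\<lambda>n. Some (h n)"])
    show "partial_recursive (\<lambda>n. Some (h n))" using h(1) unfolding recursive_def .
  qed (simp_all add: h(2) remainder_in_terms halting_inequality)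
qed

end
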